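(* Let $N\ge1$ and consider the domain $\Omega=\{\mathbf w=(f_0,\alpha,f_2,\dots,f_N)^T\in\mathbb R^{N+1}:\ \alpha\in(-1,1),\ f_0\ne0\}$ and the coefficient matrix $\mathbf A(\mathbf w)=\tilde{\mathbf D}(\mathbf w)^{-1}\tilde{\mathbf M}(\mathbf w)\tilde{\mathbf D}(\mathbf w)$. Let $\lambda^{(N)}_0(\mathbf w)<\dots<\lambda^{(N)}_N(\mathbf w)$ be its eigenvalues (which depend only on $\alpha$ and are the zeros of $\tilde\phi_{N+1}$). Then the characteristic fields associated with $\lambda^{(N)}_0$ and $\lambda^{(N)}_N$ are genuinely nonlinear on $\Omega$: for $k\in\{0,N\}$, every $\mathbf w\in\Omega$, and every nonzero right eigenvector $\mathbf R$ of $\mathbf A(\mathbf w)$ for $\lambda^{(N)}_k(\mathbf w)$, one has $\nabla_{\mathbf w}\lambda^{(N)}_k(\mathbf w)\cdot\mathbf R\neq0$.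
   Context: For a parameter $\alpha\in(-1,1)$ define on $[-1,1]$ the weights $\omega(\mu)=(1+\alpha\mu)^{-4}$ and $\tilde\omega(\mu)=(1+\alpha\mu)^{-5}$. Let $\{\phi_k\}_{k\ge0}$ (resp. $\{\tilde\phi_k\}_{k\ge0}$) be the monic orthogonal polynomials on $[-1,1]$ with respect to $\omega$ (resp. $\tilde\omega$); their coefficients depend smoothly on $\alpha$. Set $K_{j,k}=\int_{-1}^1\mu^j\phi_k\,\omega\,d\mu$, $\tilde K_{j,k}=\int_{-1}^1\mu^j\tilde\phi_k\,\tilde\omega\,d\mu$, $\beta_k=K_{k,k}/\tilde K_{k,k}$, $\gamma_k=\tilde K_{k,k}^{-1}\,\partial K_{k,k}/\partial\alpha$. Given $\mathbf w=(f_0,\alpha,f_2,\dots,f_N)^T$, set $f_1:=0$. The $(N+1)\times(N+1)$ matrix $\tilde{\mathbf D}=\tilde{\mathbf D}(\mathbf w)$ (rows/columns indexed $0,\dots,N$) has entries $\tilde D_{0,0}=\beta_0$, $\tilde D_{0,1}=\gamma_0f_0$, $\tilde D_{1,0}=\alpha$, $\tilde D_{1,1}=-4f_0$; for $2\le i\le N$: $\tilde D_{i,1}=\gamma_if_i-4f_{i-1}$, $\tilde D_{i,i}=\beta_i$, and $\tilde D_{i,i-1}=\alpha$ when $i\ge3$; all other entries are $0$. Let $\tilde{\boldsymbol\Lambda}=\mathrm{diag}(\tilde K_{0,0},\dots,\tilde K_{N,N})$ and $\tilde{\mathbf M}=\tilde{\boldsymbol\Lambda}^{-1}\mathbf G$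 where $G_{i,j}=\int_{-1}^1\mu\,\tilde\phi_i\tilde\phi_j\,\tilde\omega\,d\mu$, $0\le i,j\le N$. *)

theory Defs
  imports "HOL-Analysis.Analysis" "Jordan_Normal_Form.Char_Poly"
    "Jordan_Normal_Form.Gauss_Jordan_Elimination"
begin

text \<open>Weight (1 + alpha mu)^(-m) on [-1,1]; m = 4 gives omega, m = 5 gives omega-tilde.\<close>
definition wgt :: "nat \<Rightarrow> real \<Rightarrow> real \<Rightarrow> real" where
  "wgt m \<alpha> \<mu> = inverse ((1 + \<alpha> * \<mu>) ^ m)"

definition ophi :: "nat \<Rightarrow> real \<Rightarrow> nat \<Rightarrow> real poly" where
  "ophi m \<alpha> k = (THE p. degree p = k \<and> lead_coeff p = 1 \<and>
      (\<forall>q. degree q < k \<longrightarrow>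
         integral {-1..1} (\<lambda>\<mu>. poly p \<mu> * poly q \<mu> * wgt m \<alpha> \<mu>) = 0))"

definition Kc :: "nat \<Rightarrow> real \<Rightarrow> nat \<Rightarrow> nat \<Rightarrow> real" where
  "Kc m \<alpha> j k = integral {-1..1} (\<lambda>\<mu>. \<mu> ^ j * poly (ophi m \<alpha> k) \<mu> * wgt m \<alpha> \<mu>)"

definition betac :: "real \<Rightarrow> nat \<Rightarrow> real" where
  "betac \<alpha> k = Kc 4 \<alpha> k k / Kc 5 \<alpha> k k"

definition gammac :: "real \<Rightarrow> nat \<Rightarrow> real" where
  "gammac \<alpha> k = deriv (\<lambda>a. Kc 4 a k k) \<alpha> / Kc 5 \<alpha> k k"

text \<open>Components f_i of w = (f_0, alpha, f_2, ..., f_N), with the convention f_1 := 0.\<close>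
definition fcomp :: "real vec \<Rightarrow> nat \<Rightarrow> real" where
  "fcomp w i = (if i = 1 then 0 else w $ i)"

definition Dt :: "nat \<Rightarrow> real vec \<Rightarrow> real mat" where
  "Dt N w = (let \<alpha> = w $ 1; f = fcomp w in
     mat (N+1) (N+1) (\<lambda>(i,j).
       if i = 0 \<and> j = 0 then betac \<alpha> 0
       else if i = 0 \<and> j = 1 then gammac \<alpha> 0 * f 0
       else if i = 1 \<and> j = 0 then \<alpha>
       else if i = 1 \<and> j = 1 then -4 * f 0
       else if 2 \<le> i \<and> j = 1 then gammac \<alpha> i * f i - 4 * f (i - 1)
       else if 2 \<le> i \<and> j = i then betac \<alpha> i
       else if 3 \<le> i \<and> j = i - 1 then \<alpha>
       else 0))"

text \<open>M-tilde = Lambda-tilde^(-1) G.\<close>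
definition Mt :: "nat \<Rightarrow> real vec \<Rightarrow> real mat" where
  "Mt N w = (let \<alpha> = w $ 1 in
     mat (N+1) (N+1) (\<lambda>(i,j).
       integral {-1..1} (\<lambda>\<mu>. \<mu> * poly (ophi 5 \<alpha> i) \<mu> * poly (ophi 5 \<alpha> j) \<mu> * wgt 5 \<alpha> \<mu>)
       / Kc 5 \<alpha> i i))"

definition Amat :: "nat \<Rightarrow> real vec \<Rightarrow> real mat" where
  "Amat N w = the (mat_inverse (Dt N w)) * Mt N w * Dt N w"

definition lam :: "nat \<Rightarrow> nat \<Rightarrow> real vec \<Rightarrow> real" where
  "lam N k w = sorted_list_of_set {x. eigenvalue (Amat N w) x} ! k"

definition Omega :: "nat \<Rightarrow> real vec set" where
  "Omega N = {w. w \<in> carrier_vec (N+1) \<and> -1 < w $ 1 \<and> w $ 1 < 1 \<and> w $ 0 \<noteq> 0}"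

end

theory Submission
  imports Defs
begin

text \<open>
  The eigenvalues of \<open>Amat N w\<close> are the zeros of \<open>p = ophi 5 \<alpha> (N+1)\<close>, and they depend on
  \<open>\<alpha> = w $ 1\<close> only, so the assertion is \<open>\<lambda>'(\<alpha>) * R $ 1 \<noteq> 0\<close>. For the first factor, Markov's
  argument gives \<open>\<lambda>' < 0\<close> for every zero, because \<open>\<partial>\<^sub>\<alpha> ln \<omega>(\<mu>) = -5 \<mu> / (1 + \<alpha> \<mu>)\<close> is strictly
  decreasing in \<open>\<mu>\<close>. For the second, an eigenvector \<open>v\<close> of \<open>Mt N w\<close> is the coefficient vector of a
  multiple of \<open>l = p / (X - \<lambda>)\<close> in the basis \<open>ophi 5 \<alpha> j\<close>, and solving the first two rows of
  \<open>Dt N w R = v\<close> writes \<open>R $ 1\<close> as the integral of \<open>l L\<close> against \<open>\<omega>\<close>, where \<open>L\<close> is linear and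
  orthogonal to \<open>1 + \<alpha> X\<close>. By Gauss quadrature this integral is a nonzero multiple of \<open>L(\<lambda>)\<close>, and
  quadrature applied to \<open>L (1 + \<alpha> X)\<close> shows that \<open>L\<close> cannot vanish at an extreme node.
\<close>

unbundle no vec_syntax

subsection \<open>Weighted integrals of polynomials\<close>

lemma one_plus_mult_pos:
  fixes a x :: real
  assumes "a \<in> {-1<..<1}" "x \<in> {-1..1}"
  shows "1 + a * x > 0"
proof -
  have "\<bar>a * x\<bar> \<le> \<bar>a\<bar> * 1"
    unfolding abs_mult using assms by (intro mult_left_mono) auto
  then show ?thesis using assms by auto
qed

lemma wgt_pos: "a \<in> {-1<..<1} \<Longrightarrow> x \<in> {-1..1} \<Longrightarrow> wgt m a x > 0"
  using one_plus_mult_pos by (simp add: wgt_def)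

lemma continuous_on_wgt_joint:
  "continuous_on ({-1<..<1} \<times> {-1..1}) (\<lambda>z. wgt m (fst z) (snd z))"
  unfolding wgt_def
proof (intro continuous_intros ballI)
  fix z :: "real \<times> real" assume "z \<in> {-1<..<1} \<times> {-1..1}"
  then have "1 + fst z * snd z > 0" by (intro one_plus_mult_pos) auto
  then show "(1 + fst z * snd z) ^ m \<noteq> 0" by simp
qed

lemma continuous_on_wgt: "a \<in> {-1<..<1} \<Longrightarrow> continuous_on {-1..1} (wgt m a)"
  unfolding wgt_def
proof (intro continuous_intros ballI)
  fix x :: real assume "a \<in> {-1<..<1}" "x \<in> {-1..1}"
  then have "1 + a * x > 0" by (rule one_plus_mult_pos)
  then show "(1 + a * x) ^ m \<noteq> 0" by simp
qed

lemma wgt_Suc: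
  assumes "a \<in> {-1<..<1}" "x \<in> {-1..1}"
  shows "(1 + a * x) * wgt (Suc m) a x = wgt m a x"
  using one_plus_mult_pos[OF assms] by (simp add: wgt_def)

definition wint :: "nat \<Rightarrow> real \<Rightarrow> real poly \<Rightarrow> real" where
  "wint m a q = integral {-1..1} (\<lambda>x. poly q x * wgt m a x)"

lemma wint_integrable:
  assumes "a \<in> {-1<..<1}"
  shows "(\<lambda>x. poly q x * wgt m a x) integrable_on {-1..1}"
  by (intro integrable_continuous_real continuous_intros continuous_on_wgt[OF assms])

lemma wint_add: "a \<in> {-1<..<1} \<Longrightarrow> wint m a (p + q) = wint m a p + wint m a q"
  unfolding wint_def by (simp add: ring_distribs integral_add wint_integrable)

lemma wint_diff: "a \<in> {-1<..<1} \<Longrightarrow> wint m a (p - q) = wint m a p - wint m a q"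
  unfolding wint_def by (simp add: left_diff_distrib integral_diff wint_integrable)

lemma wint_smult: "wint m a (Polynomial.smult c p) = c * wint m a p"
  unfolding wint_def by (simp add: mult.assoc)

lemma wint_0 [simp]: "wint m a 0 = 0"
  by (simp add: wint_def)

lemma wint_sum:
  "a \<in> {-1<..<1} \<Longrightarrow> wint m a (\<Sum>i\<in>A. f i) = (\<Sum>i\<in>A. wint m a (f i))"
  by (induction A rule: infinite_finite_induct) (auto simp: wint_add)

text \<open>The link between weights of neighbouring exponents: it ties \<open>betac\<close> and
  \<open>gammac\<close> to the exponent-5 inner product and later isolates the sign in the
  monotonicity argument.\<close>

lemma wint_Suc:
  assumes "a \<in> {-1<..<1}"
  shows "wint (Suc m) a ([:1, a:] * q) = wint m a q"
  unfolding wint_def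
proof (rule integral_cong)
  fix x :: real assume "x \<in> {-1..1}"
  have "poly ([:1, a:] * q) x * wgt (Suc m) a x = poly q x * ((1 + a * x) * wgt (Suc m) a x)"
    by (simp add: algebra_simps)
  also have "\<dots> = poly q x * wgt m a x"
    by (simp only: wgt_Suc[OF assms \<open>x \<in> {-1..1}\<close>])
  finally show "poly ([:1, a:] * q) x * wgt (Suc m) a x = poly q x * wgt m a x" .
qed

text \<open>A nonnegative continuous integrand with vanishing integral is zero on all of [-1,1]; as
  the weight is positive there, \<open>q\<close> would have infinitely many roots.\<close>

lemma wint_pos:
  assumes a: "a \<in> {-1<..<1}" and q: "q \<noteq> 0" and nn: "\<And>x. x \<in> {-1..1} \<Longrightarrow> poly q x \<ge> 0"
  shows "wint m a q > 0"
proof -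
  have nn': "poly q x * wgt m a x \<ge> 0" if "x \<in> {-1..1}" for x
    using nn[OF that] wgt_pos[OF a that, of m] by simp
  have "wint m a q \<noteq> 0"
  proof
    assume "wint m a q = 0"
    moreover have "continuous_on {-1..1} (\<lambda>x. poly q x * wgt m a x)"
      by (intro continuous_intros continuous_on_wgt[OF a])
    ultimately have "\<forall>x\<in>{-1..1}. poly q x * wgt m a x = 0"
      using integral_eq_0_iff[of "-1" 1 "\<lambda>x. poly q x * wgt m a x"] nn' by (simp add: wint_def)
    then have "{-1..1} \<subseteq> {x. poly q x = 0}"
      using wgt_pos[OF a, of _ m] by force
    then have "finite {-1..1::real}"
      using poly_roots_finite[OF q] finite_subset by blast
    then show False using infinite_Icc[of "-1" "1::real"] by simp
  qed
  moreover have "wint m a q \<ge> 0"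
    unfolding wint_def using wint_integrable[OF a] nn' by (intro integral_nonneg) auto
  ultimately show ?thesis by simp
qed

lemma wint_square_pos: "a \<in> {-1<..<1} \<Longrightarrow> p \<noteq> 0 \<Longrightarrow> wint m a (p * p) > 0"
  by (rule wint_pos) auto

subsection \<open>Orthogonal polynomials\<close>

text \<open>The predicate behind the \<open>THE\<close> in \<open>ophi\<close>, isolated so that
  existence and uniqueness can be settled before the description is used.\<close>

definition monic_orth :: "nat \<Rightarrow> real \<Rightarrow> nat \<Rightarrow> real poly \<Rightarrow> bool" where
  "monic_orth m a k p \<longleftrightarrow>
     degree p = k \<and> lead_coeff p = 1 \<and> (\<forall>q. degree q < k \<longrightarrow> wint m a (p * q) = 0)"

lemma monic_orth_nonzero: "monic_orth m a k p \<Longrightarrow> p \<noteq> 0"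
  by (auto simp: monic_orth_def)

text \<open>The zero polynomial has degree 0, so for \<open>n = 0\<close> the strict degree bound
  fails although the difference vanishes; hence the disjunction.\<close>

lemma degree_reduce:
  fixes q p :: "real poly"
  assumes "degree q \<le> n" "degree p = n" "lead_coeff p = 1"
  shows "n = 0 \<and> q - Polynomial.smult (coeff q n) p = 0 \<or> degree (q - Polynomial.smult (coeff q n) p) < n"
proof -
  let ?r = "q - Polynomial.smult (coeff q n) p"
  have "degree ?r \<le> n"
    using assms by (intro degree_diff_le) (auto intro: order.trans[OF degree_smult_le])
  moreover have "coeff ?r n = 0" using assms by auto
  ultimately show ?thesis
    using leading_coeff_0_iff[of ?r] by (cases "degree ?r = n") auto
qed

text \<open>Strong induction on the degree of \<open>q\<close>: subtracting a multiple of
  \<open>P (degree q)\<close> removes the leading term, and both that multiple and the remainder are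
  orthogonal to \<open>r\<close>.\<close>

lemma orthogonal_to_span:
  assumes a: "a \<in> {-1<..<1}"
    and P: "\<And>j. j < n \<Longrightarrow> degree (P j) = j \<and> lead_coeff (P j) = 1"
    and orth: "\<And>j. j < n \<Longrightarrow> wint m a (r * P j) = 0"
    and "degree q < n"
  shows "wint m a (r * q) = 0"
  using \<open>degree q < n\<close>
proof (induction "degree q" arbitrary: q rule: less_induct)
  case less
  let ?d = "degree q" 
  let ?s = "q - Polynomial.smult (lead_coeff q) (P ?d)"
  have "?s = 0 \<or> degree ?s < ?d"
    using degree_reduce[of q ?d "P ?d"] P[OF less.prems] by auto
  then have "wint m a (r * ?s) = 0"
    using less.hyps[of ?s] less.prems by auto
  then show ?case
    using orth[OF less.prems] by (simp add: right_diff_distrib wint_diff[OF a] wint_smult)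
qed

lemma orthogonal_to_self_eq_0:
  assumes a: "a \<in> {-1<..<1}" and "wint m a (r * r) = 0"
  shows "r = 0"
  using wint_square_pos[OF a, of r m] assms(2) by fastforce

text \<open>The leading terms cancel in \<open>p - q\<close>, so both polynomials are orthogonal to
  \<open>p - q\<close>, which is then orthogonal to itself.\<close>

lemma monic_orth_unique:
  assumes a: "a \<in> {-1<..<1}" and p: "monic_orth m a k p" and q: "monic_orth m a k q"
  shows "p = q"
proof -
  have dp: "degree p = k" "coeff p k = 1" and dq: "degree q = k" "lead_coeff q = 1"
    using p q by (auto simp: monic_orth_def)
  have "k = 0 \<and> p - q = 0 \<or> degree (p - q) < k"
    using degree_reduce[of p k q] dp(1) dq unfolding dp(2) by simp
  then show ?thesis
  proof
    assume "degree (p - q) < k"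
    then have "wint m a ((p - q) * (p - q)) = 0"
      using p q unfolding monic_orth_def left_diff_distrib[of p q "p - q"] wint_diff[OF a] by simp
    then have "p - q = 0" by (rule orthogonal_to_self_eq_0[OF a])
    then show ?thesis by simp
  qed simp
qed

text \<open>The Gram-Schmidt formula is kept explicit because it serves twice: for existence, and
  for the continuity of the coefficients of \<open>ophi\<close> in the parameter.\<close>

lemma monic_orth_gram_schmidt:
  assumes a: "a \<in> {-1<..<1}" and P: "\<And>j. j < n \<Longrightarrow> monic_orth m a j (P j)"
  shows "monic_orth m a n
    (monom 1 n - (\<Sum>j<n. Polynomial.smult (wint m a (monom 1 n * P j) / wint m a (P j * P j)) (P j)))"
    (is "monic_orth m a n (_ - ?s)")
proof -
  have dP: "degree (P j) = j" if "j < n" for j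
    using P[OF that] by (simp add: monic_orth_def)
  have s: "coeff ?s i = 0" if "i \<ge> n" for i
    using that by (auto simp: coeff_sum intro!: sum.neutral coeff_eq_0 simp: dP)
  have "degree (monom 1 n - ?s) \<le> n"
    by (intro degree_le) (auto simp: s)
  moreover have c: "coeff (monom 1 n - ?s) n = 1" by (simp add: s)
  moreover have "n \<le> degree (monom 1 n - ?s)"
    by (rule le_degree) (simp add: s)
  ultimately have deg: "degree (monom 1 n - ?s) = n" by simp
  have PP: "wint m a (P i * P j) = 0" if "i < n" "j < n" "i \<noteq> j" for i j
  proof (cases "i < j")
    case True
    then have "wint m a (P j * P i) = 0" using P[OF that(2)] dP[OF that(1)] by (simp add: monic_orth_def)
    then show ?thesis by (simp add: mult.commute)
  next
    case False
    then show ?thesis using P[OF that(1)] dP[OF that(2)] that(3) by (simp add: monic_orth_def)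
  qed
  have "wint m a ((monom 1 n - ?s) * P i) = 0" if i: "i < n" for i
  proof -
    have nz: "wint m a (P i * P i) \<noteq> 0"
      using wint_square_pos[OF a monic_orth_nonzero[OF P[OF i]], of m] by simp
    have "wint m a (?s * P i)
        = (\<Sum>j<n. wint m a (monom 1 n * P j) / wint m a (P j * P j) * wint m a (P j * P i))"
      by (simp add: sum_distrib_right wint_sum[OF a] wint_smult)
    also have "\<dots> = (\<Sum>j<n. if j = i then wint m a (monom 1 n * P i) else 0)"
      using PP i nz by (intro sum.cong) auto
    also have "\<dots> = wint m a (monom 1 n * P i)" using i by simp
    finally show ?thesis by (simp add: left_diff_distrib wint_diff[OF a])
  qed
  then have "wint m a ((monom 1 n - ?s) * q) = 0" if "degree q < n" for q
    using orthogonal_to_span[OF a, of n P m _ q] P[unfolded monic_orth_def] that by blast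
  then show ?thesis using deg c by (simp add: monic_orth_def)
qed

lemma monic_orth_exists:
  assumes a: "a \<in> {-1<..<1}"
  shows "\<exists>p. monic_orth m a k p"
proof (induction k rule: less_induct)
  case (less k)
  then obtain P where "\<And>j. j < k \<Longrightarrow> monic_orth m a j (P j)" by metis
  from monic_orth_gram_schmidt[OF a this] show ?case by blast
qed

section \<open>The polynomials \<open>ophi\<close> as an orthogonal basis\<close>

lemma ophi_monic_orth:
  assumes a: "a \<in> {-1<..<1}"
  shows "monic_orth m a k (ophi m a k)"
proof -
  have "ophi m a k = (THE p. monic_orth m a k p)"
    by (simp add: ophi_def monic_orth_def wint_def)
  moreover obtain p where "monic_orth m a k p" using monic_orth_exists[OF a] by blast
  then have "monic_orth m a k (THE p. monic_orth m a k p)"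
    by (rule theI) (rule monic_orth_unique[OF a _ \<open>monic_orth m a k p\<close>])
  ultimately show ?thesis by simp
qed

lemma degree_ophi: "a \<in> {-1<..<1} \<Longrightarrow> degree (ophi m a k) = k"
  and lead_coeff_ophi: "a \<in> {-1<..<1} \<Longrightarrow> lead_coeff (ophi m a k) = 1"
  and ophi_nonzero: "a \<in> {-1<..<1} \<Longrightarrow> ophi m a k \<noteq> 0"
  and ophi_orthogonal: "a \<in> {-1<..<1} \<Longrightarrow> degree q < k \<Longrightarrow> wint m a (ophi m a k * q) = 0"
  using ophi_monic_orth[of a m k] by (auto simp: monic_orth_def)

lemma ophi_0: "a \<in> {-1<..<1} \<Longrightarrow> ophi m a 0 = 1"
  using degree_ophi[of a m 0] lead_coeff_ophi[of a m 0]
  by (auto elim!: degree_eq_zeroE simp: one_pCons)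

lemma ophi_gram_schmidt:
  assumes a: "a \<in> {-1<..<1}"
  shows "ophi m a n = monom 1 n - (\<Sum>j<n. Polynomial.smult (wint m a (monom 1 n * ophi m a j) /
    wint m a (ophi m a j * ophi m a j)) (ophi m a j))"
  by (rule monic_orth_unique[OF a ophi_monic_orth[OF a]
        monic_orth_gram_schmidt[OF a ophi_monic_orth[OF a]]])

lemma ophi_pairwise_orthogonal:
  assumes a: "a \<in> {-1<..<1}" and "i \<noteq> j"
  shows "wint m a (ophi m a i * ophi m a j) = 0"
proof (cases "i < j")
  case True
  then have "wint m a (ophi m a j * ophi m a i) = 0"
    by (intro ophi_orthogonal[OF a]) (simp add: degree_ophi[OF a])
  then show ?thesis by (simp add: mult.commute)
next
  case False
  then show ?thesis using assms by (intro ophi_orthogonal[OF a]) (simp add: degree_ophi[OF a])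
qed

lemma orthogonal_to_ophi_eq_0:
  assumes a: "a \<in> {-1<..<1}" and "degree r < n"
    and "\<And>j. j < n \<Longrightarrow> wint m a (r * ophi m a j) = 0"
  shows "r = 0"
  using orthogonal_to_span[OF a, of n "ophi m a" m r r] assms degree_ophi[OF a] lead_coeff_ophi[OF a]
    orthogonal_to_self_eq_0[OF a] by blast

lemma ophi_expansion:
  assumes a: "a \<in> {-1<..<1}" and "degree q < n"
  shows "q = (\<Sum>j<n. Polynomial.smult (wint m a (q * ophi m a j) / wint m a (ophi m a j * ophi m a j)) (ophi m a j))"
    (is "_ = ?s")
proof -
  have "degree ?s \<le> n - 1"
    by (intro degree_sum_le) (auto simp: degree_ophi[OF a] intro: order.trans[OF degree_smult_le])
  then have "degree (q - ?s) < n"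
    using assms(2) by (intro degree_diff_less) auto
  moreover have "wint m a ((q - ?s) * ophi m a i) = 0" if i: "i < n" for i
  proof -
    have nz: "wint m a (ophi m a i * ophi m a i) \<noteq> 0"
      using wint_square_pos[OF a ophi_nonzero[OF a], of m m i] by simp
    have "wint m a (?s * ophi m a i)
        = (\<Sum>j<n. wint m a (q * ophi m a j) / wint m a (ophi m a j * ophi m a j) * wint m a (ophi m a j * ophi m a i))"
      by (simp add: sum_distrib_right wint_sum[OF a] wint_smult)
    also have "\<dots> = (\<Sum>j<n. if j = i then wint m a (q * ophi m a i) else 0)"
      using ophi_pairwise_orthogonal[OF a] i nz by (intro sum.cong) auto
    also have "\<dots> = wint m a (q * ophi m a i)" using i by simp
    finally show ?thesis by (simp add: left_diff_distrib wint_diff[OF a])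
  qed
  ultimately show ?thesis using orthogonal_to_ophi_eq_0[OF a, of "q - ?s" n m] by simp
qed

text \<open>\<open>monom 1 k\<close> and \<open>ophi m a k\<close> differ by a polynomial of lower
  degree, which is orthogonal to \<open>ophi m a k\<close>. Thus the diagonal moment is a squared
  norm, hence positive.\<close>

lemma Kc_diag:
  assumes a: "a \<in> {-1<..<1}"
  shows "Kc m a k k = wint m a (ophi m a k * ophi m a k)"
proof -
  have "Kc m a k k = wint m a (ophi m a k * monom 1 k)"
    by (simp add: Kc_def wint_def poly_monom mult_ac)
  moreover have "k = 0 \<and> monom 1 k - ophi m a k = 0 \<or> degree (monom 1 k - ophi m a k) < k"
    using degree_reduce[of "monom 1 k" k "ophi m a k"] degree_ophi[OF a] lead_coeff_ophi[OF a, of m k]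
    by (auto simp: degree_monom_eq)
  then have "wint m a (ophi m a k * (monom 1 k - ophi m a k)) = 0"
    using ophi_orthogonal[OF a] by auto
  ultimately show ?thesis by (simp add: right_diff_distrib wint_diff[OF a])
qed

lemma Kc_pos: "a \<in> {-1<..<1} \<Longrightarrow> Kc m a k k > 0"
  by (simp add: Kc_diag wint_square_pos ophi_nonzero)

subsection \<open>Zeros and Gauss quadrature\<close>

text \<open>\<open>S\<close> collects the zeros of odd order in the open interval: multiplying by
  their linear factors removes every sign change, and \<open>c\<close> records the remaining sign.
  The induction splits off one root at a time.\<close>

lemma semidefinite_multiplier:
  fixes p :: "real poly"
  assumes "p \<noteq> 0"
  shows "\<exists>S c. finite S \<and> S \<subseteq> {x. -1 < x \<and> x < 1 \<and> poly p x = 0} \<and> c \<noteq> 0 \<and>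
    (\<forall>x\<in>{-1..1}. c * poly (p * (\<Prod>s\<in>S. [:-s, 1:])) x \<ge> 0)"
  using assms
proof (induction "degree p" arbitrary: p rule: less_induct)
  case less
  show ?case
  proof (cases "\<exists>x. -1 < x \<and> x < 1 \<and> poly p x = 0")
    case False
    \<comment> \<open>Without interior roots the sign is constant by the intermediate value theorem,
      so the value at 0 determines it.\<close>
    define c where "c = poly p 0"
    have c: "c \<noteq> 0" using False by (auto simp: c_def)
    have "c * poly p x > 0" if "-1 < x" "x < 1" for x
    proof (rule ccontr)
      assume "\<not> c * poly p x > 0"
      moreover have "poly p x \<noteq> 0" using False that by auto
      ultimately have neg: "poly p 0 * poly p x < 0"
        using c by (auto simp: c_def not_less le_less)
      then have "x \<noteq> 0" by (auto simp: mult_less_0_iff)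
      then consider "0 < x" | "x < 0" by linarith
      then obtain y where "poly p y = 0" "-1 < y" "y < 1"
      proof cases
        case 1
        from poly_IVT[OF 1 neg] that \<open>x < 1\<close> show ?thesis by force
      next
        case 2
        from poly_IVT[OF 2, of p] neg that \<open>-1 < x\<close> show ?thesis by (force simp: mult.commute)
      qed
      then show False using False by blast
    qed
    \<comment> \<open>The endpoints may be roots, so there the sign is obtained only weakly, by
      continuity.\<close>
    moreover have "closure {-1<..<1::real} = {-1..1}" by (rule closure_greaterThanLessThan) simp
    ultimately have "c * poly p x \<ge> 0" if "x \<in> {-1..1}" for x
      using continuous_ge_on_closure[of "{-1<..<1}" "\<lambda>x. c * poly p x" x 0] that
      by (force intro!: continuous_intros)
    then show ?thesis using c by (intro exI[of _ "{}"] exI[of _ c]) auto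
  next
    case True
    then obtain r where r: "-1 < r" "r < 1" "poly p r = 0" by blast
    then obtain q where q: "p = [:-r, 1:] * q" using poly_eq_0_iff_dvd by blast
    then have "q \<noteq> 0" using less.prems by auto
    then have "degree q < degree p" by (simp add: q degree_mult_eq del: mult_pCons_left)
    from less.hyps[OF this \<open>q \<noteq> 0\<close>] obtain S c where
      S: "finite S" "S \<subseteq> {x. -1 < x \<and> x < 1 \<and> poly q x = 0}" "c \<noteq> 0"
         "\<And>x. x \<in> {-1..1} \<Longrightarrow> c * poly (q * (\<Prod>s\<in>S. [:-s, 1:])) x \<ge> 0" by blast
    \<comment> \<open>The extra root \<open>r\<close> flips the parity of its order. If
      \<open>r\<close> is in \<open>S\<close>, its factor moves from the product into
      \<open>p\<close>; otherwise it is added to \<open>S\<close> and the two copies form a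
      square.\<close>
    show ?thesis
    proof (cases "r \<in> S")
      case True
      have "p * (\<Prod>s\<in>S - {r}. [:-s, 1:]) = q * (\<Prod>s\<in>S. [:-s, 1:])"
        unfolding q using prod.remove[OF S(1) True, of "\<lambda>s. [:-s, 1:]"]
        by (simp add: mult_ac del: mult_pCons_left mult_pCons_right)
      then show ?thesis using S q r by (intro exI[of _ "S - {r}"] exI[of _ c]) auto
    next
      case False
      have eq: "p * (\<Prod>s\<in>insert r S. [:-s, 1:]) = [:-r, 1:]^2 * (q * (\<Prod>s\<in>S. [:-s, 1:]))"
        unfolding q prod.insert[OF S(1) False]
        by (simp add: mult_ac power2_eq_square del: mult_pCons_left mult_pCons_right)
      have "c * poly (p * (\<Prod>s\<in>insert r S. [:-s, 1:])) x \<ge> 0" if "x \<in> {-1..1}" for x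
      proof -
        have "c * poly (p * (\<Prod>s\<in>insert r S. [:-s, 1:])) x
            = (x - r)^2 * (c * poly (q * (\<Prod>s\<in>S. [:-s, 1:])) x)"
          unfolding eq by (simp add: mult_ac power2_eq_square del: mult_pCons_left mult_pCons_right)
        also have "\<dots> \<ge> 0" by (rule mult_nonneg_nonneg[OF zero_le_power2 S(4)[OF that]])
        finally show ?thesis .
      qed
      then show ?thesis using S q r by (intro exI[of _ "insert r S"] exI[of _ c]) auto
    qed
  qed
qed

definition zeros :: "nat \<Rightarrow> real \<Rightarrow> nat \<Rightarrow> real set" where
  "zeros m a n = {x. poly (ophi m a n) x = 0}"

lemma degree_prod_linear: "finite S \<Longrightarrow> degree (\<Prod>s\<in>S. [:-s, 1:] :: real poly) = card S"
  by (subst degree_prod_eq_sum_degree) auto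

text \<open>With fewer than \<open>n\<close> sign changes the multiplier would have degree below
  \<open>n\<close>, so orthogonality would make the integral of a nonzero one-signed polynomial
  vanish. Hence there are \<open>n\<close> distinct zeros inside the interval, which exhaust the
  degree.\<close>

lemma
  assumes a: "a \<in> {-1<..<1}"
  shows finite_zeros: "finite (zeros m a n)" and card_zeros: "card (zeros m a n) = n"
    and zeros_subset: "zeros m a n \<subseteq> {-1<..<1}"
    and ophi_eq_prod_zeros: "ophi m a n = (\<Prod>s\<in>zeros m a n. [:-s, 1:])"
proof -
  let ?p = "ophi m a n"
  show fin: "finite (zeros m a n)"
    unfolding zeros_def by (rule poly_roots_finite[OF ophi_nonzero[OF a]])
  from semidefinite_multiplier[OF ophi_nonzero[OF a, of m n]] obtain S c where
    S: "finite S" "S \<subseteq> {x. -1 < x \<and> x < 1 \<and> poly ?p x = 0}" and c: "c \<noteq> 0"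
      "\<And>x. x \<in> {-1..1} \<Longrightarrow> c * poly (?p * (\<Prod>s\<in>S. [:-s, 1:])) x \<ge> 0" by blast
  have "n \<le> card S"
  proof (rule ccontr)
    assume "\<not> n \<le> card S"
    then have "wint m a (?p * (\<Prod>s\<in>S. [:-s, 1:])) = 0"
      by (intro ophi_orthogonal[OF a]) (simp add: degree_prod_linear S)
    moreover have "wint m a (Polynomial.smult c (?p * (\<Prod>s\<in>S. [:-s, 1:]))) > 0"
      using c S(1) ophi_nonzero[OF a, of m n] by (intro wint_pos[OF a]) (auto simp del: poly_mult)
    ultimately show False by (simp add: wint_smult)
  qed
  moreover have "S \<subseteq> zeros m a n" using S by (auto simp: zeros_def)
  moreover have "card (zeros m a n) \<le> n"
    using card_poly_roots_bound[OF ophi_nonzero[OF a, of m n]] by (simp add: zeros_def degree_ophi[OF a])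
  ultimately have "S = zeros m a n" and card: "card (zeros m a n) = n"
    using card_seteq[OF fin, of S] card_mono[OF fin, of S] by auto
  then show "card (zeros m a n) = n" and "zeros m a n \<subseteq> {-1<..<1}"
    using S by auto
  show "?p = (\<Prod>s\<in>zeros m a n. [:-s, 1:])"
  proof (rule poly_eqI_degree_lead_coeff[of _ n _ "zeros m a n"])
    show "coeff ?p n = coeff (\<Prod>s\<in>zeros m a n. [:-s, 1:]) n"
      using lead_coeff_ophi[OF a, of m n] lead_coeff_prod[of "\<lambda>s. [:-s, 1:]" "zeros m a n"]
      by (simp add: degree_ophi[OF a] degree_prod_linear fin card)
  next
    fix z assume z: "z \<in> zeros m a n"
    then show "poly ?p z = poly (\<Prod>s\<in>zeros m a n. [:-s, 1:]) z"
      using fin by (simp add: poly_prod) (simp add: zeros_def)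
  qed (auto simp: degree_ophi[OF a] degree_prod_linear fin card)
qed

section \<open>Lagrange interpolation at the zeros and Gauss quadrature\<close>

definition node_poly :: "nat \<Rightarrow> real \<Rightarrow> nat \<Rightarrow> real \<Rightarrow> real poly" where
  "node_poly m a n s = (\<Prod>t\<in>zeros m a n - {s}. [:-t, 1:])"

text \<open>The Christoffel number at \<open>s\<close>: the integral of the Lagrange basis
  polynomial, which is \<open>node_poly\<close> normalised to the value 1 at
  \<open>s\<close>.\<close>

definition gauss_wt :: "nat \<Rightarrow> real \<Rightarrow> nat \<Rightarrow> real \<Rightarrow> real" where
  "gauss_wt m a n s = wint m a (node_poly m a n s) / poly (node_poly m a n s) s"

lemma ophi_eq_node_poly:
  assumes a: "a \<in> {-1<..<1}" and s: "s \<in> zeros m a n"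
  shows "ophi m a n = [:-s, 1:] * node_poly m a n s"
  using ophi_eq_prod_zeros[OF a, of m n] prod.remove[OF finite_zeros[OF a] s, of "\<lambda>s. [:-s, 1:]"]
  by (simp add: node_poly_def)

lemma degree_node_poly:
  assumes a: "a \<in> {-1<..<1}" and s: "s \<in> zeros m a n"
  shows "degree (node_poly m a n s) = n - 1"
  using finite_zeros[OF a, of m n] card_zeros[OF a, of m n] s by (simp add: node_poly_def degree_prod_linear)

lemma poly_node_poly_eq_0_iff:
  assumes a: "a \<in> {-1<..<1}"
  shows "poly (node_poly m a n s) t = 0 \<longleftrightarrow> t \<in> zeros m a n \<and> t \<noteq> s"
  using finite_zeros[OF a, of m n] by (auto simp: node_poly_def poly_prod)

lemma node_poly_nonzero: "a \<in> {-1<..<1} \<Longrightarrow> node_poly m a n s \<noteq> 0"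
  using poly_node_poly_eq_0_iff[of a m n s s] by auto

lemma poly_pderiv_ophi_zero:
  assumes a: "a \<in> {-1<..<1}" and s: "s \<in> zeros m a n"
  shows "poly (pderiv (ophi m a n)) s = poly (node_poly m a n s) s"
  unfolding ophi_eq_node_poly[OF assms] by (simp add: pderiv_mult pderiv_pCons del: mult_pCons_left)

text \<open>Divide \<open>f\<close> by \<open>ophi m a n\<close>. The quotient has degree below
  \<open>n\<close>, so its product with \<open>ophi\<close> integrates to zero; the remainder equals
  its own Lagrange interpolant and agrees with \<open>f\<close> at the nodes.\<close>

lemma gauss_quadrature:
  assumes a: "a \<in> {-1<..<1}" and f: "degree f < 2 * n"
  shows "wint m a f = (\<Sum>s\<in>zeros m a n. gauss_wt m a n s * poly f s)"
proof -
  let ?p = "ophi m a n" and ?Z = "zeros m a n" and ?l = "node_poly m a n"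
  define d r where "d = f div ?p" and "r = f mod ?p"
  have eq: "f = ?p * d + r" by (simp add: d_def r_def)
  have n: "n > 0" using f by simp
  have "r = 0 \<or> degree r < degree ?p"
    unfolding r_def by (rule degree_mod_less[OF ophi_nonzero[OF a]])
  then have r: "degree r < n" using n by (auto simp: degree_ophi[OF a])
  have d: "degree d < n"
  proof (cases "d = 0")
    case False
    have "n + degree d = degree (?p * d)"
      using False ophi_nonzero[OF a, of m n] by (simp add: degree_mult_eq degree_ophi[OF a])
    also have "?p * d = f - r" by (simp add: eq)
    also have "degree (f - r) < 2 * n" using f r by (intro degree_diff_less) auto
    finally show ?thesis by simp
  qed (use n in simp)
  have pf: "poly f s = poly r s" if "s \<in> ?Z" for s
    using that by (simp add: eq zeros_def)
  let ?L = "\<Sum>s\<in>?Z. Polynomial.smult (poly r s / poly (?l s) s) (?l s)"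
  have lag: "r = ?L"
  proof (rule poly_eqI_degree[of ?Z])
    fix x assume x: "x \<in> ?Z"
    have "poly ?L x = (\<Sum>s\<in>?Z. if s = x then poly r x else 0)"
      unfolding poly_sum using x poly_node_poly_eq_0_iff[OF a, of m n]
      by (intro sum.cong) auto
    then show "poly r x = poly ?L x" using x finite_zeros[OF a] by simp
  next
    have "degree ?L \<le> n - 1"
      by (intro degree_sum_le finite_zeros[OF a])
         (auto simp: degree_node_poly[OF a] intro: order.trans[OF degree_smult_le])
    then show "card ?Z > degree ?L" using n card_zeros[OF a] by simp
  qed (use r card_zeros[OF a] in simp)
  have "wint m a f = wint m a r"
    unfolding eq wint_add[OF a] using ophi_orthogonal[OF a d] by simp
  also have "\<dots> = (\<Sum>s\<in>?Z. poly r s / poly (?l s) s * wint m a (?l s))"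
    by (subst lag) (simp add: wint_sum[OF a] wint_smult)
  also have "\<dots> = (\<Sum>s\<in>?Z. gauss_wt m a n s * poly f s)"
    by (intro sum.cong) (auto simp: gauss_wt_def pf)
  finally show ?thesis .
qed

text \<open>The node polynomial vanishes at every node except \<open>s\<close>, so a single term of
  the quadrature sum survives. The degree is at most \<open>n - 1 + n\<close>, still within the
  exact range.\<close>

lemma gauss_quadrature_node_poly:
  assumes a: "a \<in> {-1<..<1}" and s: "s \<in> zeros m a n" and q: "degree q \<le> n"
  shows "wint m a (node_poly m a n s * q)
    = gauss_wt m a n s * poly (node_poly m a n s) s * poly q s"
proof -
  have "n > 0" using s finite_zeros[OF a, of m n] card_zeros[OF a, of m n] by (cases n) auto
  then have "degree (node_poly m a n s * q) < 2 * n"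
    using degree_mult_le[of "node_poly m a n s" q] q degree_node_poly[OF a s] by linarith
  then have "wint m a (node_poly m a n s * q)
      = (\<Sum>t\<in>zeros m a n. gauss_wt m a n t * poly (node_poly m a n s * q) t)"
    by (rule gauss_quadrature[OF a])
  also have "\<dots> = (\<Sum>t\<in>zeros m a n. if t = s then gauss_wt m a n s * poly (node_poly m a n s) s * poly q s else 0)"
    using poly_node_poly_eq_0_iff[OF a, of m n s] by (intro sum.cong) auto
  finally show ?thesis using s finite_zeros[OF a] by simp
qed

lemma gauss_wt_pos:
  assumes a: "a \<in> {-1<..<1}" and s: "s \<in> zeros m a n"
  shows "gauss_wt m a n s > 0"
proof -
  have "0 < wint m a (node_poly m a n s * node_poly m a n s)"
    by (rule wint_square_pos[OF a node_poly_nonzero[OF a]])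
  also have "\<dots> = gauss_wt m a n s * (poly (node_poly m a n s) s)\<^sup>2"
    using gauss_quadrature_node_poly[OF a s, of "node_poly m a n s"] degree_node_poly[OF a s]
    by (simp add: power2_eq_square)
  finally show ?thesis by (simp add: zero_less_mult_iff)
qed

subsection \<open>The coefficient matrix\<close>

lemma wint_has_derivative:
  assumes a: "a \<in> {-1<..<1}"
  shows "((\<lambda>a. wint m a q) has_real_derivative - real m * wint (Suc m) a (pCons 0 q)) (at a)"
proof -
  have der: "((\<lambda>a. poly q x * wgt m a x) has_real_derivative
      poly q x * (- real m * x * wgt (Suc m) b x)) (at b within {-1<..<1})"
    if "b \<in> {-1<..<1}" "x \<in> cbox (-1) 1" for b x
  proof -
    have pos: "1 + b * x > 0" using one_plus_mult_pos that by simp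
    have "((\<lambda>a. wgt m a x) has_real_derivative
        - (inverse ((1 + b * x) ^ m) * (real m * (1 + b * x) ^ (m - 1) * x) * inverse ((1 + b * x) ^ m)))
        (at b within {-1<..<1})"
      unfolding wgt_def using pos by (auto intro!: derivative_eq_intros simp: mult_ac)
    also have "inverse ((1 + b * x) ^ m) * (real m * (1 + b * x) ^ (m - 1) * x) * inverse ((1 + b * x) ^ m)
        = real m * x * wgt (Suc m) b x"
    proof -
      have "inverse (u ^ m) * (real m * u ^ (m - 1) * x) * inverse (u ^ m) = real m * x * inverse (u ^ Suc m)"
        if "u > 0" for u
        using that by (cases m) (auto simp: field_simps)
      from this[OF pos] show ?thesis by (simp add: wgt_def)
    qed
    finally show ?thesis by (auto intro!: derivative_eq_intros)
  qed
  have "continuous_on ({-1<..<1} \<times> {-1..1})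
      (\<lambda>z. poly q (snd z) * (- real m * snd z * wgt (Suc m) (fst z) (snd z)))"
    by (intro continuous_intros continuous_on_wgt_joint)
  then have "((\<lambda>a. integral (cbox (-1) 1) (\<lambda>x. poly q x * wgt m a x)) has_real_derivative
      integral (cbox (-1) 1) (\<lambda>x. poly q x * (- real m * x * wgt (Suc m) a x))) (at a within {-1<..<1})"
    using wint_integrable a
    by (intro leibniz_rule_field_derivative der) (auto simp: case_prod_beta' box_real)
  also have "integral (cbox (-1) 1) (\<lambda>x. poly q x * (- real m * x * wgt (Suc m) a x))
      = integral (cbox (-1) 1) (\<lambda>x. - real m * (poly (pCons 0 q) x * wgt (Suc m) a x))"
    by (intro integral_cong) (auto simp: mult_ac)
  finally show ?thesis
    using a by (simp add: wint_def at_within_open[OF a])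
qed

lemma wint_4_eq_wint_5: "a \<in> {-1<..<1} \<Longrightarrow> wint 4 a q = wint 5 a ([:1, a:] * q)"
  using wint_Suc[of a 4 q] by simp

text \<open>As \<open>ophi\<close> of degree 0 is 1, the claim reduces to the integral of
  \<open>- 4 a x + 4 (1 + a x) = 4\<close> against the exponent-5 weight. It shows that the leading
  2x2 block of \<open>Dt\<close> has determinant \<open>-4 f_0\<close>.\<close>

lemma gammac_betac_0:
  assumes a: "a \<in> {-1<..<1}"
  shows "a * gammac a 0 + 4 * betac a 0 = 4"
proof -
  have K: "Kc m b 0 0 = wint m b 1" if "b \<in> {-1<..<1}" for m b
    by (simp add: Kc_diag[OF that] ophi_0[OF that])
  have "((\<lambda>b. Kc 4 b 0 0) has_real_derivative - 4 * wint 5 a [:0, 1:]) (at a)"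
  \<comment> \<open>\<open>Kc\<close> is identified with \<open>wint\<close> only for parameters in
    the open interval, so the derivative is transferred locally.\<close>
  proof (rule has_field_derivative_transform_within_open[of "\<lambda>b. wint 4 b 1" _ _ "{-1<..<1}"])
    show "((\<lambda>b. wint 4 b 1) has_real_derivative - 4 * wint 5 a [:0, 1:]) (at a)"
      using wint_has_derivative[OF a, of 4 1] by (simp add: one_pCons)
  qed (use a K in auto)
  then have "deriv (\<lambda>b. Kc 4 b 0 0) a = - 4 * wint 5 a [:0, 1:]" by (rule DERIV_imp_deriv)
  moreover have "Kc 4 a 0 0 = wint 5 a ([:1:] + Polynomial.smult a [:0, 1:])"
    using wint_4_eq_wint_5[OF a, of 1] by (simp add: K[OF a])
  then have "Kc 4 a 0 0 = wint 5 a [:1:] + a * wint 5 a [:0, 1:]"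
    unfolding wint_add[OF a] wint_smult .
  moreover have "Kc 5 a 0 0 = wint 5 a [:1:]" by (simp add: K[OF a] one_pCons)
  ultimately show ?thesis
    using Kc_pos[OF a, of 5 0] unfolding gammac_def betac_def by (simp add: field_simps)
qed

lemma betac_pos: "a \<in> {-1<..<1} \<Longrightarrow> betac a k > 0"
  by (simp add: betac_def Kc_pos)

section \<open>Structure and invertibility of \<open>Dt\<close>\<close>

lemma Dt_carrier [simp]: "Dt N w \<in> carrier_mat (N+1) (N+1)" "dim_row (Dt N w) = N+1" "dim_col (Dt N w) = N+1"
  by (simp_all add: Dt_def Let_def)

lemma Mt_carrier [simp]: "Mt N w \<in> carrier_mat (N+1) (N+1)" "dim_row (Mt N w) = N+1" "dim_col (Mt N w) = N+1"
  by (simp_all add: Mt_def Let_def)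

lemma Dt_mult_vec_index:
  assumes v: "v \<in> carrier_vec (N+1)" and "i < N+1"
  shows "(Dt N w *\<^sub>v v) $ i = (\<Sum>j<N+1. Dt N w $$ (i, j) * v $ j)"
  using assms by (simp add: scalar_prod_def atLeast0LessThan)

lemma Dt_mult_vec_0:
  assumes v: "v \<in> carrier_vec (N+1)" and N: "N \<ge> 1"
  shows "(Dt N w *\<^sub>v v) $ 0 = betac (w $ 1) 0 * v $ 0 + gammac (w $ 1) 0 * w $ 0 * v $ 1"
proof -
  have "(Dt N w *\<^sub>v v) $ 0 = (\<Sum>j<N+1. Dt N w $$ (0, j) * v $ j)"
    by (rule Dt_mult_vec_index[OF v]) simp
  also have "\<dots> = (\<Sum>j\<in>{0, 1}. Dt N w $$ (0, j) * v $ j)"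
    using N by (intro sum.mono_neutral_right) (auto simp: Dt_def Let_def)
  finally show ?thesis using N by (simp add: Dt_def Let_def fcomp_def)
qed

lemma Dt_mult_vec_1:
  assumes v: "v \<in> carrier_vec (N+1)" and N: "N \<ge> 1"
  shows "(Dt N w *\<^sub>v v) $ 1 = w $ 1 * v $ 0 - 4 * w $ 0 * v $ 1"
proof -
  have "(Dt N w *\<^sub>v v) $ 1 = (\<Sum>j<N+1. Dt N w $$ (1, j) * v $ j)"
    using N by (intro Dt_mult_vec_index[OF v]) simp
  also have "\<dots> = (\<Sum>j\<in>{0, 1}. Dt N w $$ (1, j) * v $ j)"
    using N by (intro sum.mono_neutral_right) (auto simp: Dt_def Let_def)
  finally show ?thesis using N by (simp add: Dt_def Let_def fcomp_def)
qed

text \<open>From row 2 on the matrix is lower triangular, which permits forward substitution once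
  the first two components are known.\<close>

lemma Dt_mult_vec_ge_2:
  assumes v: "v \<in> carrier_vec (N+1)" and i: "2 \<le> i" "i < N+1" and 0: "\<And>j. j < i \<Longrightarrow> v $ j = 0"
  shows "(Dt N w *\<^sub>v v) $ i = betac (w $ 1) i * v $ i"
proof -
  have "(Dt N w *\<^sub>v v) $ i = (\<Sum>j<N+1. Dt N w $$ (i, j) * v $ j)"
    by (rule Dt_mult_vec_index[OF v i(2)])
  also have "\<dots> = (\<Sum>j\<in>{i}. Dt N w $$ (i, j) * v $ j)"
  proof (intro sum.mono_neutral_right ballI)
    fix j assume "j \<in> {..<N+1} - {i}"
    then show "Dt N w $$ (i, j) * v $ j = 0"
      using i 0[of j] by (cases "j < i") (auto simp: Dt_def Let_def)
  qed (use i in auto)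
  finally show ?thesis using i by (simp add: Dt_def Let_def)
qed

lemma OmegaD:
  assumes "w \<in> Omega N"
  shows "w \<in> carrier_vec (N+1)" "w $ 1 \<in> {-1<..<1}" "w $ 0 \<noteq> 0"
  using assms by (auto simp: Omega_def)

text \<open>Cramer's rule: the first two rows involve only \<open>v $ 0\<close> and
  \<open>v $ 1\<close>, and the determinant of their block is known.\<close>

lemma Dt_mult_vec_solve_1:
  assumes w: "w \<in> Omega N" and N: "N \<ge> 1" and v: "v \<in> carrier_vec (N+1)"
  shows "4 * w $ 0 * v $ 1
    = w $ 1 * (Dt N w *\<^sub>v v) $ 0 - betac (w $ 1) 0 * (Dt N w *\<^sub>v v) $ 1"
proof -
  have "w $ 1 * (Dt N w *\<^sub>v v) $ 0 - betac (w $ 1) 0 * (Dt N w *\<^sub>v v) $ 1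
      = (w $ 1 * gammac (w $ 1) 0 + 4 * betac (w $ 1) 0) * (w $ 0 * v $ 1)"
    unfolding Dt_mult_vec_0[OF v N] Dt_mult_vec_1[OF v N] by (simp add: algebra_simps)
  then show ?thesis using gammac_betac_0[OF OmegaD(2)[OF w]] by simp
qed

text \<open>The kernel is trivial: the leading block kills the first two components, forward
  substitution the others. Hence \<open>mat_inverse\<close> returns a value and \<open>the\<close>
  in \<open>Amat\<close> is meaningful.\<close>

lemma Dt_inverse:
  assumes w: "w \<in> Omega N" and N: "N \<ge> 1"
  obtains B where "mat_inverse (Dt N w) = Some B" "B \<in> carrier_mat (N+1) (N+1)"
    "Dt N w * B = 1\<^sub>m (N+1)" "B * Dt N w = 1\<^sub>m (N+1)"
proof -
  note a = OmegaD(2)[OF w]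
  have "v = 0\<^sub>v (N+1)" if v: "v \<in> carrier_vec (N+1)" and Dv: "Dt N w *\<^sub>v v = 0\<^sub>v (N+1)" for v
  proof -
    have v1: "v $ 1 = 0"
      using Dt_mult_vec_solve_1[OF w N v] OmegaD(3)[OF w] N by (simp add: Dv)
    have v0: "v $ 0 = 0"
      using Dt_mult_vec_0[OF v N, of w] v1 betac_pos[OF a, of 0] by (simp add: Dv)
    have "v $ i = 0" if "i < N+1" for i
      using that
    proof (induction i rule: less_induct)
      case (less i)
      consider "i = 0" | "i = 1" | "2 \<le> i" by linarith
      then show ?case
      proof cases
        case 3
        have "betac (w $ 1) i * v $ i = (Dt N w *\<^sub>v v) $ i"
          using less by (intro Dt_mult_vec_ge_2[symmetric] v 3) auto
        then show ?thesis using betac_pos[OF a, of i] less.prems by (simp add: Dv)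
      qed (use v0 v1 in auto)
    qed
    then show ?thesis using v by (intro eq_vecI) auto
  qed
  then have "det (Dt N w) \<noteq> 0"
    using det_0_iff_vec_prod_zero[OF Dt_carrier(1)[of N w]] by blast
  then have "Dt N w \<in> Units (ring_mat TYPE(real) (N+1) ())"
    by (rule det_non_zero_imp_unit[OF Dt_carrier(1)])
  then obtain B where "mat_inverse (Dt N w) = Some B"
    using mat_inverse(1)[OF Dt_carrier(1)[of N w]] by fastforce
  then show ?thesis using mat_inverse(2)[OF Dt_carrier(1)[of N w]] that by blast
qed

lemma Amat_carrier:
  assumes "w \<in> Omega N" "N \<ge> 1"
  shows "Amat N w \<in> carrier_mat (N+1) (N+1)"
proof -
  obtain B where "mat_inverse (Dt N w) = Some B" "B \<in> carrier_mat (N+1) (N+1)"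
    using Dt_inverse[OF assms] by blast
  then show ?thesis unfolding Amat_def by (auto intro!: mult_carrier_mat)
qed

lemma eigenvalue_Amat:
  assumes w: "w \<in> Omega N" and N: "N \<ge> 1"
  shows "eigenvalue (Amat N w) x \<longleftrightarrow> eigenvalue (Mt N w) x"
proof -
  obtain B where B: "mat_inverse (Dt N w) = Some B" "B \<in> carrier_mat (N+1) (N+1)"
    "Dt N w * B = 1\<^sub>m (N+1)" "B * Dt N w = 1\<^sub>m (N+1)"
    using Dt_inverse[OF w N] by blast
  have "similar_mat (Amat N w) (Mt N w)"
    using B Amat_carrier[OF w N] by (intro similar_matI[of _ _ B "Dt N w" "N+1"]) (auto simp: Amat_def)
  from char_poly_similar[OF this] show ?thesis
    by (simp add: eigenvalue_root_char_poly[OF Amat_carrier[OF w N]] eigenvalue_root_char_poly[OF Mt_carrier(1)])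
qed

text \<open>\<open>Dt\<close> intertwines the two matrices, \<open>Dt * Amat = Mt * Dt\<close>, and
  is injective.\<close>

lemma eigenvector_Mt_Dt:
  assumes w: "w \<in> Omega N" and N: "N \<ge> 1" and R: "eigenvector (Amat N w) R x"
  shows "eigenvector (Mt N w) (Dt N w *\<^sub>v R) x"
proof -
  obtain B where B: "mat_inverse (Dt N w) = Some B" "B \<in> carrier_mat (N+1) (N+1)"
    "Dt N w * B = 1\<^sub>m (N+1)" "B * Dt N w = 1\<^sub>m (N+1)"
    using Dt_inverse[OF w N] by blast
  note D = Dt_carrier(1)[of N w] and M = Mt_carrier(1)[of N w]
  have Rc: "R \<in> carrier_vec (N+1)" and R0: "R \<noteq> 0\<^sub>v (N+1)" and AR: "Amat N w *\<^sub>v R = x \<cdot>\<^sub>v R"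
    using R Amat_carrier[OF w N] unfolding eigenvector_def by auto
  have DA: "Dt N w * Amat N w = Mt N w * Dt N w"
  proof -
    have "Dt N w * Amat N w = Dt N w * (B * (Mt N w * Dt N w))"
      using B D M by (simp add: Amat_def assoc_mult_mat[of B _ _ _ _ _ ])
    also have "\<dots> = (Dt N w * B) * (Mt N w * Dt N w)"
      using B D M by (intro assoc_mult_mat[symmetric, of _ "N+1" "N+1" _ "N+1" _ "N+1"]) auto
    finally show ?thesis using B(3) D M by (simp add: left_mult_one_mat[of _ "N+1" "N+1"])
  qed
  have "Mt N w *\<^sub>v (Dt N w *\<^sub>v R) = (Mt N w * Dt N w) *\<^sub>v R"
    using D M Rc by simp
  also have "\<dots> = Dt N w *\<^sub>v (Amat N w *\<^sub>v R)"
    unfolding DA[symmetric] using D Amat_carrier[OF w N] Rc by simp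
  also have "\<dots> = x \<cdot>\<^sub>v (Dt N w *\<^sub>v R)"
    unfolding AR using D Rc by (simp add: mult_mat_vec)
  finally have ev: "Mt N w *\<^sub>v (Dt N w *\<^sub>v R) = x \<cdot>\<^sub>v (Dt N w *\<^sub>v R)" .
  have "Dt N w *\<^sub>v R \<noteq> 0\<^sub>v (N+1)"
  proof
    assume 0: "Dt N w *\<^sub>v R = 0\<^sub>v (N+1)"
    have "R = (B * Dt N w) *\<^sub>v R" using B(4) Rc by simp
    also have "\<dots> = B *\<^sub>v (Dt N w *\<^sub>v R)" by (rule assoc_mult_mat_vec[OF B(2) D Rc])
    also have "\<dots> = 0\<^sub>v (N+1)" unfolding 0 using B by auto
    finally show False using R0 by simp
  qed
  then show ?thesis using ev Rc D by (simp add: eigenvector_def)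
qed

section \<open>Eigenvectors of \<open>Mt\<close> as polynomials\<close>

definition vec_poly :: "nat \<Rightarrow> real \<Rightarrow> real vec \<Rightarrow> real poly" where
  "vec_poly N a v = (\<Sum>j<N+1. Polynomial.smult (v $ j) (ophi 5 a j))"

lemma degree_vec_poly: "a \<in> {-1<..<1} \<Longrightarrow> degree (vec_poly N a v) \<le> N"
  unfolding vec_poly_def
  by (intro degree_sum_le) (auto simp: degree_ophi intro: order.trans[OF degree_smult_le])

lemma wint_vec_poly_ophi:
  assumes a: "a \<in> {-1<..<1}" and i: "i < N+1"
  shows "wint 5 a (vec_poly N a v * ophi 5 a i) = v $ i * Kc 5 a i i"
proof -
  have "wint 5 a (vec_poly N a v * ophi 5 a i)
      = (\<Sum>j<N+1. v $ j * wint 5 a (ophi 5 a j * ophi 5 a i))"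
    unfolding vec_poly_def sum_distrib_right wint_sum[OF a] by (simp add: wint_smult)
  also have "\<dots> = (\<Sum>j<N+1. if j = i then v $ i * Kc 5 a i i else 0)"
    using ophi_pairwise_orthogonal[OF a] by (intro sum.cong) (auto simp: Kc_diag[OF a])
  finally show ?thesis using i by simp
qed

text \<open>Under \<open>vec_poly\<close>, \<open>Mt\<close> acts as multiplication by X followed by
  orthogonal projection onto the polynomials of degree at most \<open>N\<close>; this is read off
  from inner products with the basis.\<close>

lemma Mt_mult_vec_index:
  assumes a: "w $ 1 \<in> {-1<..<1}" and v: "v \<in> carrier_vec (N+1)" and i: "i < N+1"
  shows "(Mt N w *\<^sub>v v) $ i * Kc 5 (w $ 1) i i
    = wint 5 (w $ 1) ([:0, 1:] * vec_poly N (w $ 1) v * ophi 5 (w $ 1) i)"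
proof -
  let ?a = "w $ 1"
  have ent: "Mt N w $$ (i, j) * Kc 5 ?a i i = wint 5 ?a ([:0, 1:] * ophi 5 ?a j * ophi 5 ?a i)"
    if "j < N+1" for j
    using that i Kc_pos[OF a, of 5 i] by (simp add: Mt_def Let_def wint_def mult_ac)
  have "(Mt N w *\<^sub>v v) $ i = (\<Sum>j<N+1. Mt N w $$ (i, j) * v $ j)"
    using v i by (simp add: scalar_prod_def atLeast0LessThan)
  then have "(Mt N w *\<^sub>v v) $ i * Kc 5 ?a i i = (\<Sum>j<N+1. v $ j * (Mt N w $$ (i, j) * Kc 5 ?a i i))"
    by (simp only: sum_distrib_left mult_ac)
  also have "\<dots> = (\<Sum>j<N+1. v $ j * wint 5 ?a ([:0, 1:] * ophi 5 ?a j * ophi 5 ?a i))"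
    by (intro sum.cong refl) (simp only: ent lessThan_iff)
  also have "\<dots> = wint 5 ?a (\<Sum>j<N+1. Polynomial.smult (v $ j) ([:0, 1:] * ophi 5 ?a j * ophi 5 ?a i))"
    unfolding wint_sum[OF a] wint_smult ..
  also have "(\<Sum>j<N+1. Polynomial.smult (v $ j) ([:0, 1:] * ophi 5 ?a j * ophi 5 ?a i))
      = [:0, 1:] * vec_poly N ?a v * ophi 5 ?a i"
    unfolding vec_poly_def sum_distrib_left sum_distrib_right
    by (simp only: mult_smult_left mult_smult_right)
  finally show ?thesis .
qed

lemma Mt_eigen_iff:
  assumes a: "w $ 1 \<in> {-1<..<1}" and v: "v \<in> carrier_vec (N+1)"
  shows "Mt N w *\<^sub>v v = x \<cdot>\<^sub>v v \<longleftrightarrow>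
    (\<forall>i<N+1. wint 5 (w $ 1) ([:-x, 1:] * vec_poly N (w $ 1) v * ophi 5 (w $ 1) i) = 0)"
proof -
  let ?a = "w $ 1"
  have *: "(Mt N w *\<^sub>v v) $ i = x * v $ i \<longleftrightarrow>
      wint 5 ?a ([:-x, 1:] * vec_poly N ?a v * ophi 5 ?a i) = 0" if i: "i < N+1" for i
  proof -
    have "[:-x, 1:] * vec_poly N ?a v * ophi 5 ?a i = [:0, 1:] * vec_poly N ?a v * ophi 5 ?a i
        - Polynomial.smult x (vec_poly N ?a v * ophi 5 ?a i)"
      by (simp add: algebra_simps)
    then have "wint 5 ?a ([:-x, 1:] * vec_poly N ?a v * ophi 5 ?a i)
        = ((Mt N w *\<^sub>v v) $ i - x * v $ i) * Kc 5 ?a i i"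
      by (simp only: wint_diff[OF a] wint_smult Mt_mult_vec_index[OF a v i, symmetric]
          wint_vec_poly_ophi[OF a i]) (simp add: algebra_simps)
    then show ?thesis using Kc_pos[OF a, of 5 i] by simp
  qed
  have "Mt N w *\<^sub>v v = x \<cdot>\<^sub>v v \<longleftrightarrow> (\<forall>i<N+1. (Mt N w *\<^sub>v v) $ i = x * v $ i)"
    using v by (auto simp: vec_eq_iff)
  then show ?thesis using * by blast
qed

text \<open>By the eigenvector equation, \<open>X - x\<close> times the polynomial of
  \<open>v\<close> has degree at most \<open>N+1\<close> and is orthogonal to all lower basis
  elements, so it is a multiple of \<open>ophi 5 a (N+1)\<close>. Evaluation at \<open>x\<close>
  shows that \<open>x\<close> is a zero.\<close>

lemma eigenvector_Mt_vec_poly: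
  assumes a: "w $ 1 \<in> {-1<..<1}" and v: "eigenvector (Mt N w) v x"
  obtains c where "c \<noteq> 0" "x \<in> zeros 5 (w $ 1) (N+1)"
    "vec_poly N (w $ 1) v = Polynomial.smult c (node_poly 5 (w $ 1) (N+1) x)"
proof -
  let ?a = "w $ 1" and ?q = "vec_poly N (w $ 1) v" and ?p = "ophi 5 (w $ 1) (N+1)"
  have vc: "v \<in> carrier_vec (N+1)" and v0: "v \<noteq> 0\<^sub>v (N+1)"
    and Mv: "Mt N w *\<^sub>v v = x \<cdot>\<^sub>v v"
    using v by (auto simp: eigenvector_def)
  have q0: "?q \<noteq> 0"
  proof
    assume "?q = 0"
    then have "v $ i = 0" if "i < N+1" for i
      using wint_vec_poly_ophi[OF a that, of v] Kc_pos[OF a, of 5 i] by simp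
    then show False using v0 vc by (auto simp: vec_eq_iff)
  qed
  have deg: "degree ([:-x, 1:] * ?q) \<le> N+1"
    using q0 degree_vec_poly[OF a, of N v] by (simp add: degree_mult_eq del: mult_pCons_left)
  \<comment> \<open>The coefficient of degree \<open>N+1\<close> is the only possible factor, since
    \<open>ophi\<close> is monic; subtracting that multiple leaves degree at most
    \<open>N\<close>.\<close>
  define c where "c = coeff ([:-x, 1:] * ?q) (N+1)"
  let ?r = "[:-x, 1:] * ?q - Polynomial.smult c ?p"
  have "degree ?r < N+1"
    using degree_reduce[OF deg degree_ophi[OF a, of 5] lead_coeff_ophi[OF a]] by (simp add: c_def)
  moreover have "wint 5 ?a (?r * ophi 5 ?a j) = 0" if "j < N+1" for j
  proof -
    have "wint 5 ?a ([:-x, 1:] * ?q * ophi 5 ?a j) = 0"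
      using Mv that unfolding Mt_eigen_iff[OF a vc] by blast
    moreover have "wint 5 ?a (?p * ophi 5 ?a j) = 0"
      using ophi_pairwise_orthogonal[OF a, of "N+1" j 5] that by simp
    ultimately show ?thesis
      by (simp only: left_diff_distrib wint_diff[OF a] mult_smult_left wint_smult)
  qed
  ultimately have "?r = 0" by (rule orthogonal_to_ophi_eq_0[OF a])
  then have eq: "[:-x, 1:] * ?q = Polynomial.smult c ?p" by simp
  have c: "c \<noteq> 0"
  proof
    assume "c = 0"
    then have "[:-x, 1:] * ?q = 0" using eq by simp
    then show False using q0 by (simp del: mult_pCons_left)
  qed
  have "poly (Polynomial.smult c ?p) x = 0" unfolding eq[symmetric] by (simp del: mult_pCons_left)
  then have x: "x \<in> zeros 5 ?a (N+1)" using c by (simp add: zeros_def)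
  have "[:-x, 1:] * ?q = [:-x, 1:] * Polynomial.smult c (node_poly 5 ?a (N+1) x)"
    unfolding eq ophi_eq_node_poly[OF a x] by (simp only: mult_smult_right)
  then have "?q = Polynomial.smult c (node_poly 5 ?a (N+1) x)"
    by (simp only: mult_left_cancel pCons_eq_0_iff one_neq_zero simp_thms)
  then show ?thesis using that c x by blast
qed

lemma eigenvalue_Mt:
  assumes a: "w $ 1 \<in> {-1<..<1}"
  shows "eigenvalue (Mt N w) x \<longleftrightarrow> x \<in> zeros 5 (w $ 1) (N+1)"
proof
  assume "eigenvalue (Mt N w) x"
  then show "x \<in> zeros 5 (w $ 1) (N+1)"
    unfolding eigenvalue_def using eigenvector_Mt_vec_poly[OF a] by metis
next
  let ?a = "w $ 1"
  assume x: "x \<in> zeros 5 ?a (N+1)"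
  let ?l = "node_poly 5 ?a (N+1) x"
  \<comment> \<open>The Fourier coefficients of the node polynomial, so that \<open>vec_poly\<close>
    recovers it and its product with \<open>X - x\<close> is \<open>ophi 5 ?a (N+1)\<close>.\<close>
  define v where "v = vec (N+1) (\<lambda>j. wint 5 ?a (?l * ophi 5 ?a j) / wint 5 ?a (ophi 5 ?a j * ophi 5 ?a j))"
  have vc: "v \<in> carrier_vec (N+1)" by (simp add: v_def)
  have "vec_poly N ?a v = (\<Sum>j<N+1. Polynomial.smult (wint 5 ?a (?l * ophi 5 ?a j)
      / wint 5 ?a (ophi 5 ?a j * ophi 5 ?a j)) (ophi 5 ?a j))"
    unfolding vec_poly_def by (intro sum.cong) (auto simp: v_def)
  also have "\<dots> = ?l"
    using ophi_expansion[OF a, of ?l "N+1" 5] degree_node_poly[OF a x] by simp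
  finally have vl: "vec_poly N ?a v = ?l" .
  have "v \<noteq> 0\<^sub>v (N+1)"
  proof
    assume "v = 0\<^sub>v (N+1)"
    then have "vec_poly N ?a v = 0" by (auto simp: vec_poly_def intro!: sum.neutral)
    then show False using vl node_poly_nonzero[OF a] by simp
  qed
  moreover have "Mt N w *\<^sub>v v = x \<cdot>\<^sub>v v"
    unfolding Mt_eigen_iff[OF a vc] vl ophi_eq_node_poly[OF a x, symmetric]
    using ophi_orthogonal[OF a] degree_ophi[OF a] by simp
  ultimately show "eigenvalue (Mt N w) x"
    unfolding eigenvalue_def eigenvector_def using vc by auto
qed

lemma lam_eq:
  assumes "w \<in> Omega N" "N \<ge> 1"
  shows "lam N k w = sorted_list_of_set (zeros 5 (w $ 1) (N+1)) ! k"
proof -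
  have "{x. eigenvalue (Amat N w) x} = zeros 5 (w $ 1) (N+1)"
    using eigenvalue_Amat[OF assms] eigenvalue_Mt[OF OmegaD(2)[OF assms(1)]] by blast
  then show ?thesis by (simp add: lam_def)
qed

subsection \<open>Continuity in the parameter\<close>

lemma poly_eq_sum_coeff:
  fixes p :: "real poly"
  assumes "degree p \<le> d"
  shows "poly p x = (\<Sum>i\<le>d. coeff p i * x ^ i)"
  unfolding poly_altdef using assms by (intro sum.mono_neutral_left) (auto simp: coeff_eq_0)

text \<open>A uniform degree bound makes the evaluation a sum of fixed length, so coefficientwise
  continuity yields joint continuity.\<close>

lemma continuous_on_poly_family:
  fixes f :: "real \<Rightarrow> real poly"
  assumes c: "\<And>i. continuous_on A (\<lambda>a. coeff (f a) i)" and d: "\<And>a. a \<in> A \<Longrightarrow> degree (f a) \<le> d"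
  shows "continuous_on (A \<times> T) (\<lambda>z. poly (f (fst z)) (snd z))"
proof -
  have "continuous_on (A \<times> T) (\<lambda>z. \<Sum>i\<le>d. coeff (f (fst z)) i * snd z ^ i)"
    by (intro continuous_intros continuous_on_compose2[OF c]) auto
  then show ?thesis
    by (rule continuous_on_eq) (auto simp: poly_eq_sum_coeff[OF d])
qed

lemma continuous_on_wint_family:
  assumes "\<And>i. continuous_on {-1<..<1} (\<lambda>a. coeff (f a) i)"
    and "\<And>a. a \<in> {-1<..<1} \<Longrightarrow> degree (f a) \<le> d"
  shows "continuous_on {-1<..<1} (\<lambda>a. wint m a (f a))"
proof -
  have "continuous_on ({-1<..<1} \<times> {-1..1}) (\<lambda>z. poly (f (fst z)) (snd z) * wgt m (fst z) (snd z))"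
    by (intro continuous_intros continuous_on_wgt_joint continuous_on_poly_family[OF assms])
  then have "continuous_on {-1<..<1} (\<lambda>a. integral (cbox (-1) 1) (\<lambda>x. poly (f a) x * wgt m a x))"
    by (intro integral_continuous_on_param) (simp add: case_prod_beta' box_real)
  then show ?thesis by (simp add: wint_def)
qed

lemma continuous_on_coeff_mult:
  fixes f g :: "real \<Rightarrow> real poly"
  assumes "\<And>i. continuous_on A (\<lambda>a. coeff (f a) i)" "\<And>i. continuous_on A (\<lambda>a. coeff (g a) i)"
  shows "continuous_on A (\<lambda>a. coeff (f a * g a) i)"
  unfolding coeff_mult by (intro continuous_intros assms)

text \<open>Induction along the Gram-Schmidt formula, whose denominators are positive squared
  norms.\<close>

lemma continuous_on_coeff_ophi:
  "continuous_on {-1<..<1} (\<lambda>a. coeff (ophi m a n) i)"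
proof (induction n arbitrary: i rule: less_induct)
  case (less n)
  have deg: "degree (p * ophi m a j) \<le> degree p + j" if "a \<in> {-1<..<1}" for p a j
    using degree_mult_le[of p "ophi m a j"] by (simp add: degree_ophi[OF that])
  have num: "continuous_on {-1<..<1} (\<lambda>a. wint m a (monom 1 n * ophi m a j))" if "j < n" for j
    using that less deg[of _ "monom 1 n"]
    by (intro continuous_on_wint_family continuous_on_coeff_mult) (auto intro!: continuous_intros)
  have den: "continuous_on {-1<..<1} (\<lambda>a. wint m a (ophi m a j * ophi m a j))" if "j < n" for j
  proof (rule continuous_on_wint_family)
    show "degree (ophi m a j * ophi m a j) \<le> j + j" if "a \<in> {-1<..<1}" for a
      using deg[OF that, of "ophi m a j" j] by (simp add: degree_ophi[OF that])
  qed (intro continuous_on_coeff_mult less that)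
  have "continuous_on {-1<..<1} (\<lambda>a. coeff (monom 1 n) i -
      (\<Sum>j<n. wint m a (monom 1 n * ophi m a j) / wint m a (ophi m a j * ophi m a j) * coeff (ophi m a j) i))"
  proof (intro continuous_intros num den less ballI)
    fix a :: real and j assume "a \<in> {-1<..<1}"
    then show "wint m a (ophi m a j * ophi m a j) \<noteq> 0"
      using wint_square_pos[OF _ ophi_nonzero] by (metis less_irrefl)
  qed auto
  then show ?case
  proof (rule continuous_on_eq)
    fix a :: real assume "a \<in> {-1<..<1}"
    show "coeff (monom 1 n) i - (\<Sum>j<n. wint m a (monom 1 n * ophi m a j) /
        wint m a (ophi m a j * ophi m a j) * coeff (ophi m a j) i) = coeff (ophi m a n) i"
      by (subst ophi_gram_schmidt[OF \<open>a \<in> {-1<..<1}\<close>, of m n]) (simp add: coeff_sum)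
  qed
qed

text \<open>All \<open>n\<close> zeros are real and simple and \<open>ophi\<close> is monic, so its
  absolute value is the product of the distances to the zeros: a small value forces a nearby
  zero.\<close>

lemma abs_poly_ophi_ge:
  assumes a: "a \<in> {-1<..<1}" and "e \<ge> 0" and "\<And>s. s \<in> zeros m a n \<Longrightarrow> e \<le> \<bar>x - s\<bar>"
  shows "e ^ n \<le> \<bar>poly (ophi m a n) x\<bar>"
proof -
  have "e ^ n = (\<Prod>s\<in>zeros m a n. e)" by (simp add: card_zeros[OF a])
  also have "\<dots> \<le> (\<Prod>s\<in>zeros m a n. \<bar>x - s\<bar>)" using assms by (intro prod_mono) auto
  also have "\<dots> = \<bar>poly (ophi m a n) x\<bar>"
    by (subst ophi_eq_prod_zeros[OF a]) (simp add: poly_prod abs_prod)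
  finally show ?thesis .
qed

text \<open>Closeness of the zero sets in the Hausdorff sense. For \<open>b\<close> near
  \<open>a\<close> the two polynomials are uniformly close on [-1,1], so a zero of one at distance
  \<open>e\<close> or more from all zeros of the other would violate the lower bound
  \<open>e ^ n\<close>.\<close>

lemma zeros_eventually_near:
  assumes a: "a \<in> {-1<..<1}" and e: "e > 0"
  shows "\<forall>\<^sub>F b in nhds a. b \<in> {-1<..<1} \<and>
    (\<forall>s\<in>zeros m b n. \<exists>t\<in>zeros m a n. \<bar>s - t\<bar> < e) \<and> (\<forall>t\<in>zeros m a n. \<exists>s\<in>zeros m b n. \<bar>s - t\<bar> < e)"
proof -
  have cont: "continuous_on ({-1<..<1} \<times> {-1..1}) (\<lambda>z. poly (ophi m (fst z) n) (snd z))"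
    by (intro continuous_on_poly_family[of _ _ n] continuous_on_coeff_ophi) (simp add: degree_ophi)
  obtain X where X: "a \<in> X" "open X" and close: "\<And>b x. b \<in> X \<inter> {-1<..<1} \<Longrightarrow> x \<in> {-1..1} \<Longrightarrow>
      \<bar>poly (ophi m b n) x - poly (ophi m a n) x\<bar> \<le> e ^ n / 2"
  proof (rule continuous_on_prod_compactE[OF cont compact_Icc a, of "e ^ n / 2"])
    show "e ^ n / 2 > 0" using e by simp
  qed (use that in \<open>auto simp: dist_real_def\<close>)
  have en: "e ^ n / 2 < e ^ n" using e by simp
  show ?thesis
  proof (rule eventually_nhds_in_open[THEN eventually_mono, of "X \<inter> {-1<..<1}"])
    fix b assume b: "b \<in> X \<inter> {-1<..<1}"
    then have b1: "b \<in> {-1<..<1}" by simp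
    have "\<exists>t\<in>zeros m a n. \<bar>s - t\<bar> < e" if "s \<in> zeros m b n" for s
    proof (rule ccontr)
      assume "\<not> ?thesis"
      then have "e ^ n \<le> \<bar>poly (ophi m a n) s\<bar>" using e by (intro abs_poly_ophi_ge[OF a]) auto
      moreover have "s \<in> {-1..1}" using that zeros_subset[OF b1, of m n] by fastforce
      moreover have "poly (ophi m b n) s = 0" using that by (simp add: zeros_def)
      ultimately show False using close[OF b, of s] en by simp
    qed
    moreover have "\<exists>s\<in>zeros m b n. \<bar>s - t\<bar> < e" if "t \<in> zeros m a n" for t
    proof (rule ccontr)
      assume "\<not> ?thesis"
      then have "e ^ n \<le> \<bar>poly (ophi m b n) t\<bar>"
        using e by (intro abs_poly_ophi_ge[OF b1]) (auto simp: abs_minus_commute)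
      moreover have "t \<in> {-1..1}" using that zeros_subset[OF a, of m n] by fastforce
      moreover have "poly (ophi m a n) t = 0" using that by (simp add: zeros_def)
      ultimately show False using close[OF b, of t] en by simp
    qed
    ultimately show "b \<in> {-1<..<1} \<and>
        (\<forall>s\<in>zeros m b n. \<exists>t\<in>zeros m a n. \<bar>s - t\<bar> < e) \<and> (\<forall>t\<in>zeros m a n. \<exists>s\<in>zeros m b n. \<bar>s - t\<bar> < e)"
      using b1 by blast
  qed (use X a in auto)
qed

lemma Min_Max_near:
  fixes A B :: "real set"
  assumes "finite A" "finite B" "A \<noteq> {}" "B \<noteq> {}"
    and AB: "\<forall>s\<in>A. \<exists>t\<in>B. \<bar>s - t\<bar> < e" and BA: "\<forall>t\<in>B. \<exists>s\<in>A. \<bar>s - t\<bar> < e"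
  shows "\<bar>Min A - Min B\<bar> < e" "\<bar>Max A - Max B\<bar> < e"
proof -
  obtain t where t: "t \<in> B" "\<bar>Min A - t\<bar> < e" using AB assms by (meson Min_in)
  obtain s where s: "s \<in> A" "\<bar>s - Min B\<bar> < e" using BA assms by (meson Min_in)
  have "Min B \<le> t" "Min A \<le> s" using assms t s by auto
  then show "\<bar>Min A - Min B\<bar> < e" using s t by linarith
  obtain t where t: "t \<in> B" "\<bar>Max A - t\<bar> < e" using AB assms by (meson Max_in)
  obtain s where s: "s \<in> A" "\<bar>s - Max B\<bar> < e" using BA assms by (meson Max_in)
  have "t \<le> Max B" "s \<le> Max A" using assms t s by auto
  then show "\<bar>Max A - Max B\<bar> < e" using s t by linarith
qed

lemma zeros_nonempty: "a \<in> {-1<..<1} \<Longrightarrow> n > 0 \<Longrightarrow> zeros m a n \<noteq> {}"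
  using card_zeros[of a m n] by auto

lemma isCont_extreme_zeros:
  assumes a: "a \<in> {-1<..<1}" and n: "n > 0"
  shows "isCont (\<lambda>b. Min (zeros m b n)) a" "isCont (\<lambda>b. Max (zeros m b n)) a"
proof -
  have near: "\<forall>\<^sub>F b in at a. dist (Min (zeros m b n)) (Min (zeros m a n)) < e \<and>
      dist (Max (zeros m b n)) (Max (zeros m a n)) < e" if "e > 0" for e
    unfolding eventually_at_filter
  proof (rule eventually_mono[OF zeros_eventually_near[OF a that, of m n]], clarify)
    fix b assume b: "b \<in> {-1<..<1}" "\<forall>s\<in>zeros m b n. \<exists>t\<in>zeros m a n. \<bar>s - t\<bar> < e"
      "\<forall>t\<in>zeros m a n. \<exists>s\<in>zeros m b n. \<bar>s - t\<bar> < e"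
    from Min_Max_near[OF finite_zeros[OF b(1)] finite_zeros[OF a] zeros_nonempty[OF b(1) n]
        zeros_nonempty[OF a n] b(2,3)]
    show "dist (Min (zeros m b n)) (Min (zeros m a n)) < e \<and>
        dist (Max (zeros m b n)) (Max (zeros m a n)) < e" by (simp add: dist_real_def)
  qed
  show "isCont (\<lambda>b. Min (zeros m b n)) a"
    unfolding isCont_def by (rule tendstoI, rule eventually_mono[OF near]) auto
  show "isCont (\<lambda>b. Max (zeros m b n)) a"
    unfolding isCont_def by (rule tendstoI, rule eventually_mono[OF near]) auto
qed

subsection \<open>Monotonicity of zeros in the parameter\<close>

text \<open>Separates two kinds of dependence on the parameter: the coefficients of
  \<open>q\<close>, known only to be continuous, and moments of a fixed \<open>p\<close>, which are
  differentiable.\<close>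

lemma wint_eq_sum_moments:
  assumes a: "a \<in> {-1<..<1}" and "degree q \<le> d"
  shows "wint m a (p * q) = (\<Sum>i\<le>d. coeff q i * wint m a (p * monom 1 i))"
proof -
  have "q = (\<Sum>i\<le>d. Polynomial.smult (coeff q i) (monom 1 i))"
    using poly_as_sum_of_monoms'[OF assms(2)] by (simp add: smult_monom)
  then have "p * q = (\<Sum>i\<le>d. Polynomial.smult (coeff q i) (p * monom 1 i))"
    by (metis (no_types, lifting) mult_smult_right sum.cong sum_distrib_left)
  then show ?thesis by (simp add: wint_sum[OF a] wint_smult)
qed

text \<open>A product rule with \<open>u\<close> merely continuous: as \<open>v a = 0\<close>, the
  difference quotient is \<open>u b\<close> times that of \<open>v\<close>.\<close>

lemma has_derivative_mult_vanishing:
  fixes u v :: "real \<Rightarrow> real"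
  assumes "isCont u a" "(v has_real_derivative D) (at a)" "v a = 0"
  shows "((\<lambda>b. u b * v b) has_real_derivative u a * D) (at a)"
proof -
  have "((\<lambda>b. u b * ((v b - v a) / (b - a))) \<longlongrightarrow> u a * D) (at a)"
    using assms(1,2) by (intro tendsto_mult) (auto simp: isCont_def has_field_derivative_iff)
  then show ?thesis using assms(3) by (simp add: has_field_derivative_iff)
qed

text \<open>Write \<open>(1 + a s) X = (X - s) + s (1 + a X)\<close>. The first summand turns the
  integrand into the square of \<open>ophi m a n\<close>; the second lowers the weight exponent and
  vanishes by orthogonality.\<close>

lemma wint_node_X_pos:
  assumes a: "a \<in> {-1<..<1}" and s: "s \<in> zeros m a n"
  shows "wint (Suc m) a ([:0, 1:] * (node_poly m a n s * ophi m a n)) > 0"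
proof -
  let ?p = "ophi m a n" and ?l = "node_poly m a n s"
  have n: "n > 0" using s finite_zeros[OF a, of m n] card_zeros[OF a, of m n] by (cases n) auto
  have "s \<in> {-1..1}" using s zeros_subset[OF a, of m n] by fastforce
  then have pos: "1 + a * s > 0" by (rule one_plus_mult_pos[OF a])
  have "Polynomial.smult (1 + a * s) [:0, 1:] = [:-s, 1:] + Polynomial.smult s [:1, a:]"
    by (simp add: algebra_simps)
  then have "Polynomial.smult (1 + a * s) ([:0, 1:] * (?l * ?p))
      = ([:-s, 1:] + Polynomial.smult s [:1, a:]) * (?l * ?p)"
    by (metis mult_smult_left)
  also have "\<dots> = ?p * ?p + Polynomial.smult s ([:1, a:] * (?p * ?l))"
    by (subst (3) ophi_eq_node_poly[OF a s])
      (simp only: distrib_left distrib_right mult_smult_left mult_smult_right mult_ac)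
  finally have "(1 + a * s) * wint (Suc m) a ([:0, 1:] * (?l * ?p))
      = wint (Suc m) a (?p * ?p) + s * wint m a (?p * ?l)"
    by (metis wint_smult wint_add[OF a] wint_Suc[OF a])
  also have "wint m a (?p * ?l) = 0"
    using n by (intro ophi_orthogonal[OF a]) (simp add: degree_node_poly[OF a s])
  finally have "0 < (1 + a * s) * wint (Suc m) a ([:0, 1:] * (?l * ?p))"
    using wint_square_pos[OF a ophi_nonzero[OF a, of m n], of "Suc m"] by simp
  then show ?thesis using pos by (rule zero_less_mult_pos)
qed

text \<open>The derivative of a zero is computed without differentiating the polynomials in the
  parameter: with \<open>l\<close> the node polynomial at \<open>a\<close>, the quadrature formula at \<open>a\<close> turns
  \<open>wint m b (ophi m b n * l) = 0\<close> into a formula for the value of \<open>ophi m b n\<close> at the zero,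
  in which only the weight has to be differentiated.\<close>

lemma ophi_at_zero_has_derivative:
  assumes a: "a \<in> {-1<..<1}" and s: "s \<in> zeros m a n"
  shows "((\<lambda>b. poly (ophi m b n) s) has_real_derivative
    real m * wint (Suc m) a ([:0, 1:] * (node_poly m a n s * ophi m a n))
      / (gauss_wt m a n s * poly (node_poly m a n s) s)) (at a)"
proof -
  let ?l = "node_poly m a n s" and ?P = "\<lambda>b. ophi m b n"
  let ?c = "gauss_wt m a n s * poly ?l s"
  have n: "n > 0" using s finite_zeros[OF a, of m n] card_zeros[OF a, of m n] by (cases n) auto
  have c: "?c \<noteq> 0"
    using gauss_wt_pos[OF a s] poly_node_poly_eq_0_iff[OF a, of m n s s] by simp
  have eq: "poly (?P b) s = - (\<Sum>i\<le>n. coeff (?P b) i * (wint m b (?l * monom 1 i) - wint m a (?l * monom 1 i))) / ?c"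
    if b: "b \<in> {-1<..<1}" for b
  proof -
    have d: "degree (?P b) \<le> n" by (simp add: degree_ophi[OF b])
    have "wint m b (?l * ?P b) = 0"
      using ophi_orthogonal[OF b, of ?l n m] n by (simp add: degree_node_poly[OF a s] mult.commute)
    moreover have "wint m a (?l * ?P b) = ?c * poly (?P b) s"
      by (rule gauss_quadrature_node_poly[OF a s d])
    ultimately show ?thesis
      using c wint_eq_sum_moments[OF b d, of m ?l] wint_eq_sum_moments[OF a d, of m ?l]
      by (simp add: right_diff_distrib sum_subtractf)
  qed
  have coeff: "isCont (\<lambda>b. coeff (?P b) i) a" for i
    using continuous_on_coeff_ophi[of m n i] a by (simp add: continuous_on_eq_continuous_at)
  have "((\<lambda>b. coeff (?P b) i * (wint m b (?l * monom 1 i) - wint m a (?l * monom 1 i))) has_real_derivative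
      coeff (?P a) i * (- real m * wint (Suc m) a (pCons 0 (?l * monom 1 i)))) (at a)" for i
    using wint_has_derivative[OF a, of m "?l * monom 1 i"]
    by (intro has_derivative_mult_vanishing coeff) (auto intro!: derivative_eq_intros)
  then have "((\<lambda>b. - (\<Sum>i\<le>n. coeff (?P b) i * (wint m b (?l * monom 1 i) - wint m a (?l * monom 1 i))) / ?c)
      has_real_derivative - (\<Sum>i\<le>n. coeff (?P a) i * (- real m * wint (Suc m) a (pCons 0 (?l * monom 1 i)))) / ?c) (at a)"
    by (intro DERIV_cdivide DERIV_minus DERIV_sum)
  also have "- (\<Sum>i\<le>n. coeff (?P a) i * (- real m * wint (Suc m) a (pCons 0 (?l * monom 1 i))))
      = real m * (\<Sum>i\<le>n. coeff (?P a) i * wint (Suc m) a ([:0, 1:] * ?l * monom 1 i))"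
    by (simp add: sum_negf sum_distrib_left mult_ac)
  also have "(\<Sum>i\<le>n. coeff (?P a) i * wint (Suc m) a ([:0, 1:] * ?l * monom 1 i))
      = wint (Suc m) a ([:0, 1:] * (?l * ?P a))"
    using wint_eq_sum_moments[OF a, of "?P a" n "Suc m" "[:0, 1:] * ?l"]
    by (simp add: degree_ophi[OF a] mult.assoc)
  finally show ?thesis
    by (rule has_field_derivative_transform_within_open[of _ _ _ "{-1<..<1}"]) (use a eq in auto)
qed

text \<open>Implicit differentiation by hand: the mean value theorem expresses the value of
  \<open>ophi m b n\<close> at \<open>r a\<close> through \<open>r a - r b\<close>, and division by
  \<open>b - a\<close> gives the difference quotient of \<open>r\<close>.\<close>

lemma zero_branch_has_negative_derivative:
  assumes a: "a \<in> {-1<..<1}" and m: "m > 0"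
    and r: "\<And>b. b \<in> {-1<..<1} \<Longrightarrow> r b \<in> zeros m b n" and cont: "isCont r a"
  shows "\<exists>D<0. (r has_real_derivative D) (at a)"
proof -
  define E where "E = real m * wint (Suc m) a ([:0, 1:] * (node_poly m a n (r a) * ophi m a n))"
  let ?l = "poly (node_poly m a n (r a)) (r a)" and ?g = "gauss_wt m a n (r a)"
  let ?F = "\<lambda>z. poly (pderiv (ophi m (fst z) n)) (snd z)"
  note ra = r[OF a]
  have E: "E > 0" using m wint_node_X_pos[OF a ra] by (simp add: E_def del: mult_pCons_left)
  have l: "?l \<noteq> 0" using poly_node_poly_eq_0_iff[OF a, of m n "r a" "r a"] by simp
  have "continuous_on ({-1<..<1} \<times> UNIV) ?F"
  proof (rule continuous_on_poly_family[of _ _ n])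
    show "continuous_on {-1<..<1} (\<lambda>a. coeff (pderiv (ophi m a n)) i)" for i
      unfolding coeff_pderiv by (intro continuous_intros continuous_on_coeff_ophi)
  qed (simp add: degree_pderiv degree_ophi)
  then have F: "isCont ?F (a, r a)"
    using a by (subst (asm) continuous_on_eq_continuous_at) (auto intro: open_Times)
  \<comment> \<open>This form of the mean value theorem covers either order of \<open>r b\<close>
    and \<open>r a\<close>, and also equality.\<close>
  have "\<exists>x\<in>{min (r b) (r a)..max (r b) (r a)}.
      poly (ophi m b n) (r a) - poly (ophi m b n) (r b) = (r a - r b) * poly (pderiv (ophi m b n)) x" for b
    by (rule poly_MVT') simp
  then obtain \<xi> where \<xi>: "\<And>b. \<xi> b \<in> {min (r b) (r a)..max (r b) (r a)}"
    "\<And>b. poly (ophi m b n) (r a) - poly (ophi m b n) (r b) = (r a - r b) * poly (pderiv (ophi m b n)) (\<xi> b)"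
    by metis
  have "(\<xi> \<longlongrightarrow> r a) (at a)"
  proof (rule tendsto_sandwich)
    show "((\<lambda>b. min (r b) (r a)) \<longlongrightarrow> r a) (at a)" "((\<lambda>b. max (r b) (r a)) \<longlongrightarrow> r a) (at a)"
      using tendsto_min[OF isContD[OF cont] tendsto_const[of "r a"]]
        tendsto_max[OF isContD[OF cont] tendsto_const[of "r a"]] by simp_all
  qed (use \<xi>(1) in auto)
  then have "((\<lambda>b. (b, \<xi> b)) \<longlongrightarrow> (a, r a)) (at a)" by (intro tendsto_intros)
  from isCont_tendsto_compose[OF F this]
  have Fl: "((\<lambda>b. poly (pderiv (ophi m b n)) (\<xi> b)) \<longlongrightarrow> ?l) (at a)"
    by (simp add: poly_pderiv_ophi_zero[OF a ra])
  have "((\<lambda>b. poly (ophi m b n) (r a)) has_real_derivative E / (?g * ?l)) (at a)"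
    unfolding E_def by (rule ophi_at_zero_has_derivative[OF a ra])
  then have "((\<lambda>b. poly (ophi m b n) (r a) / (b - a)) \<longlongrightarrow> E / (?g * ?l)) (at a)"
    using ra by (simp add: has_field_derivative_iff zeros_def)
  from tendsto_minus[OF tendsto_divide[OF this Fl l]]
  have lim: "((\<lambda>b. - (poly (ophi m b n) (r a) / (b - a) / poly (pderiv (ophi m b n)) (\<xi> b)))
      \<longlongrightarrow> - (E / (?g * ?l) / ?l)) (at a)" .
  have ev: "\<forall>\<^sub>F b in at a. - (poly (ophi m b n) (r a) / (b - a) / poly (pderiv (ophi m b n)) (\<xi> b))
      = (r b - r a) / (b - a)"
  proof -
    have "\<forall>\<^sub>F b in at a. b \<in> {-1<..<1}"
      using a by (intro eventually_at_in_open') auto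
    \<comment> \<open>Dividing by the derivative at \<open>\<xi> b\<close> is legitimate near
      \<open>a\<close> because its limit \<open>?l\<close> is nonzero.\<close>
    then show ?thesis using tendsto_imp_eventually_ne[OF Fl l]
    proof eventually_elim
      case (elim b)
      have "poly (ophi m b n) (r b) = 0" using r[OF elim(1)] by (simp add: zeros_def)
      then have "poly (ophi m b n) (r a) = (r a - r b) * poly (pderiv (ophi m b n)) (\<xi> b)"
        using \<xi>(2)[of b] by simp
      then show ?case using elim(2) by (simp add: minus_divide_left)
    qed
  qed
  have "(r has_real_derivative - (E / (?g * ?l) / ?l)) (at a)"
    unfolding has_field_derivative_iff by (rule Lim_transform_eventually[OF lim ev])
  \<comment> \<open>The sign of \<open>?l\<close> varies from zero to zero, but only its square
    enters.\<close>
  moreover have "E / (?g * ?l) / ?l > 0"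
  proof -
    have "E / (?g * ?l) / ?l = E / (?g * ?l\<^sup>2)" by (simp add: power2_eq_square mult.assoc)
    also have "\<dots> > 0" using E l gauss_wt_pos[OF a ra] by simp
    finally show ?thesis .
  qed
  ultimately show ?thesis by (intro exI[of _ "- (E / (?g * ?l) / ?l)"]) simp
qed

subsection \<open>Genuine nonlinearity\<close>

lemma sorted_list_of_set_nth_extreme:
  fixes S :: "real set"
  assumes "finite S" "card S = N+1"
  shows "sorted_list_of_set S ! 0 = Min S" "sorted_list_of_set S ! N = Max S"
proof -
  let ?xs = "sorted_list_of_set S"
  have len: "length ?xs = N+1" and set: "set ?xs = S" and sorted: "sorted ?xs" using assms by auto
  have nth: "?xs ! i \<in> S" if "i \<le> N" for i using nth_mem[of i ?xs] that unfolding len set by simp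
  have ex: "\<exists>i\<le>N. x = ?xs ! i" if "x \<in> S" for x
  proof -
    from that have "x \<in> set ?xs" by (simp only: set)
    then obtain i where "i < length ?xs" "?xs ! i = x" by (auto simp only: in_set_conv_nth)
    then show ?thesis unfolding len by (intro exI[of _ i]) auto
  qed
  have mono: "?xs ! i \<le> ?xs ! j" if "i \<le> j" "j \<le> N" for i j
    using sorted_nth_mono[OF sorted that(1)] that(2) unfolding len by simp
  have "Min S = ?xs ! 0"
    using assms(1) nth[of 0] by (intro Min_eqI) (auto dest!: ex intro: mono)
  then show "?xs ! 0 = Min S" ..
  have "Max S = ?xs ! N"
    using assms(1) nth[of N] by (intro Max_eqI) (auto dest!: ex intro: mono)
  then show "?xs ! N = Max S" ..
qed

text \<open>Quadrature gives a sum over nodes \<open>t\<close> of a positive factor times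
  \<open>t - s\<close>. At an extreme node no two terms have opposite signs, and
  \<open>n \<ge> 2\<close> supplies a node other than \<open>s\<close>.\<close>

lemma wint_linear_at_extreme_zero_nonzero:
  assumes a: "a \<in> {-1<..<1}" and n: "n \<ge> 2" and s: "s = Min (zeros m a n) \<or> s = Max (zeros m a n)"
  shows "wint m a ([:-s, 1:] * [:1, a:]) \<noteq> 0"
proof -
  let ?Z = "zeros m a n"
  note fin = finite_zeros[OF a, of m n]
  \<comment> \<open>This sign treats the smallest and the largest node at once.\<close>
  define \<sigma> :: real where "\<sigma> = (if s = Min ?Z then 1 else -1)"
  have \<sigma>: "\<sigma> \<noteq> 0" by (simp add: \<sigma>_def)
  have nn: "\<sigma> * (t - s) \<ge> 0" if "t \<in> ?Z" for t
    using s that fin by (auto simp: \<sigma>_def)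
  have pos: "gauss_wt m a n t * (1 + a * t) > 0" if "t \<in> ?Z" for t
    using gauss_wt_pos[OF a that] one_plus_mult_pos[OF a, of t] that zeros_subset[OF a, of m n]
    by (fastforce intro: mult_pos_pos)
  obtain t where t: "t \<in> ?Z" "t \<noteq> s"
  proof -
    have "\<not> ?Z \<subseteq> {s}"
      using card_mono[of "{s}" ?Z] card_zeros[OF a, of m n] n by auto
    then show ?thesis using that by blast
  qed
  have "degree ([:-s, 1:] * [:1, a:]) < 2 * n"
    using degree_mult_le[of "[:-s, 1:]" "[:1, a:]"] n by (auto intro: le_less_trans)
  from gauss_quadrature[OF a this]
  have "\<sigma> * wint m a ([:-s, 1:] * [:1, a:])
      = (\<Sum>t\<in>?Z. (gauss_wt m a n t * (1 + a * t)) * (\<sigma> * (t - s)))"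
    by (simp add: sum_distrib_left algebra_simps)
  also have "\<dots> > 0"
  proof (rule sum_pos2[OF fin t(1)])
    have "\<sigma> * (t - s) \<noteq> 0" using \<sigma> t by simp
    then have "\<sigma> * (t - s) > 0" using nn[OF t(1)] by linarith
    then show "0 < (gauss_wt m a n t * (1 + a * t)) * (\<sigma> * (t - s))"
      using pos[OF t(1)] by simp
    show "0 \<le> (gauss_wt m a n u * (1 + a * u)) * (\<sigma> * (u - s))" if "u \<in> ?Z" for u
      using pos[OF that] nn[OF that] by simp
  qed
  finally show ?thesis by auto
qed

lemma eigenvector_component_1_nonzero:
  assumes w: "w \<in> Omega N" and N: "N \<ge> 1"
    and x: "x = Min (zeros 5 (w $ 1) (N+1)) \<or> x = Max (zeros 5 (w $ 1) (N+1))"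
    and R: "eigenvector (Amat N w) R x"
  shows "R $ 1 \<noteq> 0"
proof
  assume R1: "R $ 1 = 0"
  define a where "a = w $ 1"
  have a: "a \<in> {-1<..<1}" unfolding a_def by (rule OmegaD(2)[OF w])
  define v where "v = Dt N w *\<^sub>v R"
  have ev: "eigenvector (Mt N w) v x" unfolding v_def by (rule eigenvector_Mt_Dt[OF w N R])
  obtain c where c: "c \<noteq> 0" and xz: "x \<in> zeros 5 a (N+1)"
    and q: "vec_poly N a v = Polynomial.smult c (node_poly 5 a (N+1) x)"
    using eigenvector_Mt_vec_poly[OF OmegaD(2)[OF w] ev] unfolding a_def by blast
  let ?l = "node_poly 5 a (N+1) x"
  have Rc: "R \<in> carrier_vec (N+1)"
    using R Amat_carrier[OF w N] unfolding eigenvector_def by auto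
  have v01: "a * v $ 0 = betac a 0 * v $ 1"
    using Dt_mult_vec_solve_1[OF w N Rc] R1 by (simp add: v_def a_def)
  define h0 h1 where "h0 = Kc 5 a 0 0" and "h1 = Kc 5 a 1 1"
  have h: "h0 > 0" "h1 > 0" using Kc_pos[OF a] by (auto simp: h0_def h1_def)
  \<comment> \<open>Dividing by the squared norms \<open>h0\<close> and \<open>h1\<close> makes the
    pairing of \<open>L\<close> with \<open>vec_poly N a v\<close> equal to
    \<open>a * v $ 0 - betac a 0 * v $ 1\<close>, which is zero when
    \<open>R $ 1 = 0\<close>.\<close>
  define L where "L = Polynomial.smult (a / h0) 1 - Polynomial.smult (betac a 0 / h1) (ophi 5 a 1)"
  have L1: "degree L \<le> 1"
    unfolding L_def by (intro degree_diff_le) (auto simp: degree_ophi[OF a] intro: order.trans[OF degree_smult_le])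
  have wi: "wint 5 a (vec_poly N a v * L) = a / h0 * wint 5 a (vec_poly N a v * ophi 5 a 0)
      - betac a 0 / h1 * wint 5 a (vec_poly N a v * ophi 5 a 1)"
    unfolding L_def right_diff_distrib wint_diff[OF a] mult_smult_right wint_smult ophi_0[OF a] ..
  have "wint 5 a (vec_poly N a v * L) = a * v $ 0 - betac a 0 * v $ 1"
    unfolding wi using wint_vec_poly_ophi[OF a, of 0 N v] wint_vec_poly_ophi[OF a, of 1 N v] N h
    by (simp add: h0_def h1_def)
  then have "c * wint 5 a (?l * L) = 0"
    using v01 by (simp add: q wint_smult)
  then have "gauss_wt 5 a (N+1) x * poly ?l x * poly L x = 0"
    using c gauss_quadrature_node_poly[OF a xz, of L] L1 by simp
  then have Lx: "poly L x = 0"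
    using gauss_wt_pos[OF a xz] poly_node_poly_eq_0_iff[OF a, of 5 "N+1" x x] by simp
  then obtain k where k: "L = [:-x, 1:] * k" using poly_eq_0_iff_dvd by blast
  \<comment> \<open>\<open>L\<close> has degree exactly 1, so vanishing at \<open>x\<close> makes it
    a nonzero multiple of \<open>X - x\<close>.\<close>
  have cL: "coeff L 1 \<noteq> 0"
    using lead_coeff_ophi[OF a, of 5 1] betac_pos[OF a, of 0] h by (simp add: L_def degree_ophi[OF a])
  have "k \<noteq> 0" using cL k by auto
  then have "degree L = 1 + degree k" unfolding k by (simp add: degree_mult_eq del: mult_pCons_left)
  then have "degree k = 0" using L1 by simp
  then obtain d where "k = [:d:]" by (rule degree_eq_zeroE)
  then have Ld: "L = Polynomial.smult d [:-x, 1:]" and d: "d \<noteq> 0"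
    using k \<open>k \<noteq> 0\<close> by (auto simp: mult.commute)
  \<comment> \<open>\<open>1 + a X\<close> pairs with the first two basis polynomials to
    \<open>betac a 0 * h0\<close> and \<open>a * h1\<close>, so the two contributions
    cancel.\<close>
  have "wint 5 a (L * [:1, a:]) = 0"
  proof -
    have "wint 5 a (L * [:1, a:]) = a / h0 * wint 5 a ([:1, a:] * 1) - betac a 0 / h1 * wint 5 a (ophi 5 a 1 * [:1, a:])"
      unfolding L_def left_diff_distrib wint_diff[OF a] mult_smult_left wint_smult by simp
    also have "wint 5 a ([:1, a:] * 1) = betac a 0 * h0"
      using h wint_4_eq_wint_5[OF a, of 1] Kc_diag[OF a, of 4 0] by (simp add: betac_def h0_def ophi_0[OF a])
    also have "wint 5 a (ophi 5 a 1 * [:1, a:]) = a * h1"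
    proof -
      have "[:1, a:] = [:1:] + Polynomial.smult a (monom 1 1)" by (simp add: monom_altdef)
      then have "wint 5 a (ophi 5 a 1 * [:1, a:]) = wint 5 a (ophi 5 a 1 * [:1:]) + a * wint 5 a (ophi 5 a 1 * monom 1 1)"
        by (simp only: distrib_left wint_add[OF a] mult_smult_right wint_smult)
      moreover have "wint 5 a (ophi 5 a 1 * [:1:]) = 0" by (rule ophi_orthogonal[OF a]) simp
      moreover have "wint 5 a (ophi 5 a 1 * monom 1 1) = h1"
        by (simp add: h1_def Kc_def wint_def poly_monom mult_ac)
      ultimately show ?thesis by simp
    qed
    finally show ?thesis using h by simp
  qed
  then have "wint 5 a ([:-x, 1:] * [:1, a:]) = 0"
    using d unfolding Ld mult_smult_left wint_smult by simp
  moreover have "wint 5 a ([:-x, 1:] * [:1, a:]) \<noteq> 0"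
    using x N unfolding a_def[symmetric] by (intro wint_linear_at_extreme_zero_nonzero[OF a, of "N+1"]) auto
  ultimately show False by simp
qed

theorem theorem2:
  fixes N k :: nat and w R :: "real vec"
  assumes "N \<ge> 1" and "k \<in> {0, N}" and "w \<in> Omega N"
    and "eigenvector (Amat N w) R (lam N k w)"
  shows "\<exists>g :: nat \<Rightarrow> real.
           (\<forall>j < N+1. ((\<lambda>t. lam N k (w + t \<cdot>\<^sub>v unit_vec (N+1) j)) has_real_derivative g j) (at 0))
         \<and> (\<Sum>j < N+1. g j * R $ j) \<noteq> 0"
proof -
  note N = assms(1) and w = assms(3) and a = OmegaD(2)[OF assms(3)]
  define r where "r b = (if k = 0 then Min (zeros 5 b (N+1)) else Max (zeros 5 b (N+1)))" for b
  have lam: "lam N k u = r (u $ 1)" if "u \<in> Omega N" for u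
    using assms(2) sorted_list_of_set_nth_extreme[OF finite_zeros card_zeros, OF OmegaD(2)[OF that] OmegaD(2)[OF that]]
    by (auto simp: lam_eq[OF that N] r_def)
  have rz: "r b \<in> zeros 5 b (N+1)" if "b \<in> {-1<..<1}" for b
    using finite_zeros[OF that, of 5 "N+1"] zeros_nonempty[OF that, of "N+1" 5] by (simp add: r_def)
  have "isCont r (w $ 1)"
    using isCont_extreme_zeros[OF a, of "N+1" 5] by (cases "k = 0") (simp_all add: r_def[abs_def])
  from zero_branch_has_negative_derivative[OF a _ rz this]
  obtain D where D: "D < 0" "(r has_real_derivative D) (at (w $ 1))" by auto
  \<comment> \<open>The eigenvalue depends on \<open>w\<close> through \<open>w $ 1\<close> alone,
    so the gradient has a single nonzero entry.\<close>
  define g where "g j = (if j = 1 then D else 0)" for j :: nat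
  have "((\<lambda>t. lam N k (w + t \<cdot>\<^sub>v unit_vec (N+1) j)) has_real_derivative g j) (at 0)" if j: "j < N+1" for j
  proof -
    \<comment> \<open>A radius within which shifting any one coordinate stays in
      \<open>Omega N\<close>, where \<open>lam\<close> is given by the zeros.\<close>
    define e :: real where "e = Min {\<bar>w $ 0\<bar>, 1 - w $ 1, 1 + w $ 1}"
    have e: "e > 0" "e \<le> \<bar>w $ 0\<bar>" "e \<le> 1 - w $ 1" "e \<le> 1 + w $ 1"
      using a OmegaD(3)[OF w] by (auto simp: e_def)
    have idx: "(w + t \<cdot>\<^sub>v unit_vec (N+1) j) $ i = w $ i + (if i = j then t else 0)" if "i < N+1" for t i
      using OmegaD(1)[OF w] that j by (auto simp: unit_vec_def)
    have Om: "w + t \<cdot>\<^sub>v unit_vec (N+1) j \<in> Omega N" if "t \<in> {-e<..<e}" for t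
      using OmegaD(1)[OF w] that e N a idx[of 0 t] idx[of 1 t] unfolding Omega_def
      by (auto split: if_splits)
    have "((\<lambda>t. r (w $ 1 + (if 1 = j then t else 0))) has_real_derivative g j) (at 0)"
    proof (cases "j = 1")
      case True
      then show ?thesis using D(2) DERIV_shift[of r D 0 "w $ 1"] by (simp add: g_def add.commute)
    qed (simp add: g_def)
    then show ?thesis
      by (rule has_field_derivative_transform_within_open[of _ _ _ "{-e<..<e}"])
         (use e N Om lam idx in auto)
  qed
  moreover have "(\<Sum>j<N+1. g j * R $ j) \<noteq> 0"
  proof -
    have "lam N k w = Min (zeros 5 (w $ 1) (N+1)) \<or> lam N k w = Max (zeros 5 (w $ 1) (N+1))"
      by (simp add: lam[OF w] r_def)
    from eigenvector_component_1_nonzero[OF w N this assms(4)] have "R $ 1 \<noteq> 0" .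
    moreover have "(\<Sum>j<N+1. g j * R $ j) = (\<Sum>j<N+1. if j = 1 then D * R $ 1 else 0)"
      by (intro sum.cong) (auto simp: g_def)
    then have "(\<Sum>j<N+1. g j * R $ j) = D * R $ 1" using N by simp
    ultimately show ?thesis using D(1) by simp
  qed
  ultimately show ?thesis by blast
qed

end
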